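(* Let $n\ge 2$ and $t\ge 1$ be integers. Let $X\subset S^{n-2}$ be a spherical $t$-design on $S^{n-2}$, and let $r$ be a root of the polynomial $Q_{n,t}(s)$. Set $$X'=\left\{\left(r,\sqrt{1-r^2}\,x\right)\in S^{n-1} \;\middle|\; x\in X\right\}.$$ Then $X'$ is a spherical design of harmonic index $t$ on $S^{n-1}$.
   Context: $S^{n-1}$ denotes the unit sphere centered at the origin in $\mathbb{R}^n$ (so $S^{n-2}\subset\mathbb{R}^{n-1}$, and $(r,\sqrt{1-r^2}\,x)$ is regarded as a point of $\mathbb{R}\times\mathbb{R}^{n-1}=\mathbb{R}^n$). Spherical $t$-design: a finite nonempty subset $X\subset S^{m-1}$ is a spherical $t$-design on $S^{m-1}$ if for every polynomial $f(x_1,\dots,x_m)$ of degree at most $t$, $\frac{1}{|S^{m-1}|}\int_{S^{m-1}}f\,d\sigma=\frac1{|X|}\sum_{x\in X}f(x)$, where $\sigma$ is the $O(\mathbb{R}^m)$-invariant measure on $S^{m-1}$ and $|S^{m-1}|$ is the total volume. $\mathrm{Harm}_t(\mathbb{R}^n)$ is the space of real homogeneous polynomials $f$ of degree $t$ in $n$ variables with $\Delta f=0$, where $\Delta=\sum_i\partial^2/\partial x_i^2$. A finite nonempty subset $X\subset S^{n-1}$ is a spherical design of harmonic index $t$ if $\sum_{x\in X}f(x)=0$ for every $f\in\mathrm{Harm}_t(\mathbb{R}^n)$. $Q_{n,t}$: let $C_t^\lambda(x)$ be the Gegenbauer polynomial of degree $t$, defined for $\lambda\ne0$ by $(1-2xr+r^2)^{-\lambda}=\sum_{t\ge0}C_t^\lambda(x)r^t$,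 and for $\lambda=0$ by the Chebyshev polynomial of the first kind $C_t^0(x)=\cos(t\arccos x)$. Then $Q_{n,t}(x)=A_{n,t}C_t^{(n-2)/2}(x)$, where the constant $A_{n,t}$ is chosen so that $Q_{n,t}(1)=\binom{n+t-1}{t}-\binom{n+t-3}{t-2}$ (a binomial coefficient with negative lower entry is $0$). All roots of $Q_{n,t}$ are real and lie in $[-1,1]$. *)

theory Defs
  imports "HOL-Complex_Analysis.Complex_Analysis"
begin

text \<open>
  Everything is stated for an arbitrary Euclidean space, with coordinates \<^term>\<open>x \<bullet> b\<close> for
  \<^term>\<open>b \<in> Basis\<close>, so that it applies both to \<^typ>\<open>real^'m\<close> and to the product
  \<^typ>\<open>real \<times> real^'m\<close>, whose norm is the Euclidean one.
\<close>

section \<open>Polynomial functions\<close>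

definition monomial :: "('a::euclidean_space \<Rightarrow> nat) \<Rightarrow> 'a \<Rightarrow> real"
  where "monomial \<alpha> x = (\<Prod>b\<in>Basis. (x \<bullet> b) ^ \<alpha> b)"

definition polynomial_of_degree_le :: "nat \<Rightarrow> ('a::euclidean_space \<Rightarrow> real) \<Rightarrow> bool"
  where "polynomial_of_degree_le t f \<longleftrightarrow>
    (\<exists>A c. finite A \<and> (\<forall>\<alpha>\<in>A. (\<Sum>b\<in>Basis. \<alpha> b) \<le> t) \<and> f = (\<lambda>x. \<Sum>\<alpha>\<in>A. c \<alpha> * monomial \<alpha> x))"

definition homogeneous_polynomial :: "nat \<Rightarrow> ('a::euclidean_space \<Rightarrow> real) \<Rightarrow> bool"
  where "homogeneous_polynomial t f \<longleftrightarrow>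
    (\<exists>A c. finite A \<and> (\<forall>\<alpha>\<in>A. (\<Sum>b\<in>Basis. \<alpha> b) = t) \<and> f = (\<lambda>x. \<Sum>\<alpha>\<in>A. c \<alpha> * monomial \<alpha> x))"

definition laplacian :: "('a::euclidean_space \<Rightarrow> real) \<Rightarrow> 'a \<Rightarrow> real"
  where "laplacian f x = (\<Sum>b\<in>Basis. (deriv ^^ 2) (\<lambda>s. f (x + s *\<^sub>R b)) 0)"

definition Harm :: "nat \<Rightarrow> ('a::euclidean_space \<Rightarrow> real) set"
  where "Harm t = {f. homogeneous_polynomial t f \<and> (\<forall>x. laplacian f x = 0)}"

section \<open>The invariant measure on the unit sphere\<close>

text \<open>
  The area of a Borel subset of the sphere is the dimension times the Lebesgue measure of the
  cone over it; the library has no surface measure. The lemmas below show that this is a finite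
  nonzero measure invariant under the orthogonal group, which determines it up to scaling.
\<close>

definition sphere_measure :: "'a::euclidean_space measure"
  where "sphere_measure =
    density (distr (restrict_space lborel (ball 0 1 - {0})) (restrict_space borel (sphere 0 1))
              (\<lambda>x. x /\<^sub>R norm x))
            (\<lambda>_. ennreal (real DIM('a)))"

lemma sphere_measure_space [simp]: "space (sphere_measure :: 'a::euclidean_space measure) = sphere 0 1"
  by (simp add: sphere_measure_def space_restrict_space)

lemma sphere_measure_sets [simp, measurable_cong]:
  "sets (sphere_measure :: 'a::euclidean_space measure) = sets (restrict_space borel (sphere 0 1))"
  by (simp add: sphere_measure_def)

lemma normalize_measurable:
  "(\<lambda>x::'a::euclidean_space. x /\<^sub>R norm x)
     \<in> restrict_space lborel (ball 0 1 - {0}) \<rightarrow>\<^sub>M restrict_space borel (sphere 0 1)"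
  by (intro measurable_restrict_space3) (auto simp: measurable_lborel2)

lemma emeasure_sphere_measure:
  fixes A :: "'a::euclidean_space set"
  assumes "A \<in> sets sphere_measure"
  shows "emeasure sphere_measure A =
    ennreal (real DIM('a)) * emeasure lborel {x \<in> ball 0 1 - {0}. x /\<^sub>R norm x \<in> A}"
proof -
  have A: "A \<in> sets (restrict_space borel (sphere 0 1))"
    using assms by simp
  define S where "S = {x \<in> ball 0 1 - {0}. x /\<^sub>R norm x \<in> A}"
  have S: "(\<lambda>x. x /\<^sub>R norm x) -` A \<inter> space (restrict_space lborel (ball 0 1 - {0})) = S"
    by (auto simp: S_def space_restrict_space)
  have "S \<subseteq> ball 0 1 - {0}"
    by (auto simp: S_def)
  then have "emeasure (distr (restrict_space lborel (ball 0 1 - {0})) (restrict_space borel (sphere 0 1))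
      (\<lambda>x. x /\<^sub>R norm x)) A = emeasure lborel S"
    unfolding emeasure_distr[OF normalize_measurable A] S
    by (intro emeasure_restrict_space) auto
  with A show ?thesis
    unfolding sphere_measure_def S_def[symmetric] by (simp add: emeasure_density_const)
qed

lemma emeasure_sphere_measure_sphere:
  "emeasure (sphere_measure :: 'a::euclidean_space measure) (sphere 0 1)
     = ennreal (real DIM('a) * measure lborel (ball 0 1 :: 'a set))"
proof -
  have "sphere (0::'a) 1 \<in> sets sphere_measure"
    using sets.top[of "sphere_measure :: 'a measure"] by simp
  moreover have "{x \<in> ball 0 1 - {0::'a}. x /\<^sub>R norm x \<in> sphere 0 1} = ball 0 1 - {0}"
    by auto
  moreover have "emeasure lborel (ball 0 1 - {0::'a}) = emeasure lborel (ball 0 1 :: 'a set)"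
    by (intro emeasure_Diff_null_set) (auto simp: null_sets_def)
  moreover have "emeasure lborel (ball 0 1 :: 'a set) = ennreal (measure lborel (ball 0 1 :: 'a set))"
    by (intro emeasure_eq_ennreal_measure) (use emeasure_lborel_ball_finite[of "0::'a" 1] in auto)
  ultimately show ?thesis
    by (simp add: emeasure_sphere_measure ennreal_mult)
qed

lemma measure_sphere_measure_sphere_pos:
  "measure (sphere_measure :: 'a::euclidean_space measure) (sphere 0 1) > 0"
  using content_ball_pos[of 1 "0::'a"]
  by (simp add: measure_def emeasure_sphere_measure_sphere )

lemma finite_measure_sphere_measure: "finite_measure (sphere_measure :: 'a::euclidean_space measure)"
  by (rule finite_measureI) (simp add: emeasure_sphere_measure_sphere)

lemma distr_lborel_orthogonal:
  fixes g :: "'a::euclidean_space \<Rightarrow> 'a"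
  assumes g: "orthogonal_transformation g"
  shows "distr lborel borel g = lborel"
proof (rule measure_eqI)
  have lin: "linear g"
    using g by (rule orthogonal_transformation_linear)
  have [measurable]: "g \<in> borel_measurable borel"
    using lin by (intro borel_measurable_continuous_onI linear_continuous_on) (simp add: linear_conv_bounded_linear)
  fix A :: "'a set"
  assume "A \<in> sets (distr lborel borel g)"
  then have [measurable]: "A \<in> sets borel"
    by simp
  have emeasure_distr_g: "emeasure (distr lborel borel g) S = (\<integral>\<^sup>+x. indicator S (g x) \<partial>lborel)"
    if [measurable]: "S \<in> sets borel" for S
  proof -
    have "emeasure (distr lborel borel g) S = (\<integral>\<^sup>+x. indicator S x \<partial>distr lborel borel g)"
      by simp
    also have "\<dots> = (\<integral>\<^sup>+x. indicator S (g x) \<partial>lborel)"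
      by (rule nn_integral_distr) auto
    finally show ?thesis .
  qed
  have plus: "(\<integral>\<^sup>+x. h (c + x) \<partial>lborel) = (\<integral>\<^sup>+x. h x \<partial>lborel)"
    if [measurable]: "h \<in> borel_measurable borel" for c and h :: "'a \<Rightarrow> ennreal"
    by (subst (2) lborel_distr_plus[of c, symmetric]) (simp add: nn_integral_distr)
  have minus: "(\<integral>\<^sup>+y. h (c - y) \<partial>lborel) = (\<integral>\<^sup>+x. h x \<partial>lborel)"
    if [measurable]: "h \<in> borel_measurable borel" for c and h :: "'a \<Rightarrow> ennreal"
  proof -
    have "lborel = distr lborel borel (\<lambda>y. c - y)"
      using lborel_affine[of "-1" c] by (simp add: density_1)
    then have "(\<integral>\<^sup>+x. h x \<partial>lborel) = (\<integral>\<^sup>+x. h x \<partial>distr lborel borel (\<lambda>y. c - y))"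
      by simp
    also have "\<dots> = (\<integral>\<^sup>+y. h (c - y) \<partial>lborel)"
      by (rule nn_integral_distr) auto
    finally show ?thesis ..
  qed
  let ?B = "ball 0 1 :: 'a set"
  have [measurable]: "?B \<in> sets borel"
    by simp
  have "emeasure (distr lborel borel g) A * emeasure lborel ?B
      = (\<integral>\<^sup>+x. indicator A (g x) * (\<integral>\<^sup>+y. indicator ?B (g x + y) \<partial>lborel) \<partial>lborel)"
  proof -
    have "(\<integral>\<^sup>+y. indicator ?B (x + y) \<partial>lborel) = emeasure lborel ?B" for x
      using plus[of "indicator ?B" x] by (simp add: borel_measurable_indicator)
    then show ?thesis
      by (simp add: emeasure_distr_g nn_integral_multc)
  qed
  also have "\<dots> = (\<integral>\<^sup>+x. (\<integral>\<^sup>+y. indicator A (g x) * indicator ?B (g x + y) \<partial>lborel) \<partial>lborel)"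
    by (intro nn_integral_cong nn_integral_cmult[symmetric]) auto
  also have "\<dots> = (\<integral>\<^sup>+y. (\<integral>\<^sup>+x. indicator A (g x) * indicator ?B (g x + y) \<partial>lborel) \<partial>lborel)"
    by (rule lborel_pair.Fubini'[symmetric]) measurable
  also have "\<dots> = (\<integral>\<^sup>+y. (\<integral>\<^sup>+x. indicator A (g x - y) * indicator ?B (g x) \<partial>lborel) \<partial>lborel)"
  proof (rule nn_integral_cong)
    fix y :: 'a
    obtain z where z: "g z = y"
      using orthogonal_transformation_surj[OF g] by (metis surjD)
    have "g (-z + x) = g x - y" for x
      using z linear_diff[OF lin, of x z] by simp
    then show "(\<integral>\<^sup>+x. indicator A (g x) * indicator ?B (g x + y) \<partial>lborel)
        = (\<integral>\<^sup>+x. (indicator A (g x - y) * indicator ?B (g x) :: ennreal) \<partial>lborel)"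
      using plus[of "\<lambda>x. indicator A (g x) * indicator ?B (g x + y)" "-z"] by simp
  qed
  also have "\<dots> = (\<integral>\<^sup>+x. (\<integral>\<^sup>+y. indicator A (g x - y) * indicator ?B (g x) \<partial>lborel) \<partial>lborel)"
    by (rule lborel_pair.Fubini') measurable
  also have "\<dots> = (\<integral>\<^sup>+x. emeasure lborel A * indicator ?B (g x) \<partial>lborel)"
    by (intro nn_integral_cong) (simp add: nn_integral_multc minus)
  also have "\<dots> = emeasure lborel A * emeasure lborel ?B"
  proof -
    have "indicator ?B (g x) = (indicator ?B x :: ennreal)" for x
      using orthogonal_transformation_norm[OF g] by (simp add: indicator_def)
    then show ?thesis
      by (simp add: nn_integral_cmult)
  qed
  finally have *: "emeasure (distr lborel borel g) A * emeasure lborel ?B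
      = emeasure lborel A * emeasure lborel ?B" .
  have B: "emeasure lborel ?B = ennreal (measure lborel ?B)"
    by (intro emeasure_eq_ennreal_measure) (use emeasure_lborel_ball_finite[of "0::'a" 1] in auto)
  have "measure lborel ?B > 0"
    using content_ball_pos[of 1 "0::'a"] by simp
  with B have "emeasure lborel ?B \<noteq> 0" "emeasure lborel ?B \<noteq> top"
    by auto
  with * show "emeasure (distr lborel borel g) A = emeasure lborel A"
    by (simp add: mult.commute[of _ "emeasure lborel ?B"] ennreal_mult_cancel_left)
qed simp

lemma distr_sphere_measure_orthogonal:
  fixes g :: "'a::euclidean_space \<Rightarrow> 'a"
  assumes g: "orthogonal_transformation g"
  shows "distr sphere_measure sphere_measure g = sphere_measure"
proof (rule measure_eqI)
  have lin: "linear g"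
    using g by (rule orthogonal_transformation_linear)
  have gm: "g \<in> borel_measurable borel"
    using lin by (intro borel_measurable_continuous_onI linear_continuous_on) (simp add: linear_conv_bounded_linear)
  have norm_g: "norm (g x) = norm x" for x
    using g by (rule orthogonal_transformation_norm)
  have gs: "g \<in> sphere_measure \<rightarrow>\<^sub>M sphere_measure"
    unfolding measurable_cong_sets[OF sphere_measure_sets sphere_measure_sets]
    by (intro measurable_restrict_space3 gm) (auto simp: norm_g)
  fix A :: "'a set"
  assume "A \<in> sets (distr sphere_measure sphere_measure g)"
  then have A: "A \<in> sets sphere_measure"
    by simp
  define S where "S = {x \<in> ball 0 1 - {0}. x /\<^sub>R norm x \<in> A}"
  have "(\<lambda>x. x /\<^sub>R norm x) -` A \<inter> space (restrict_space lborel (ball 0 1 - {0}))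
      \<in> sets (restrict_space lborel (ball 0 1 - {0}))"
    using A by (intro measurable_sets[OF normalize_measurable]) simp
  also have "(\<lambda>x. x /\<^sub>R norm x) -` A \<inter> space (restrict_space lborel (ball 0 1 - {0})) = S"
    by (auto simp: S_def space_restrict_space)
  finally have S: "S \<in> sets borel"
    by (subst (asm) sets_restrict_space_iff) auto
  have gA: "g -` A \<inter> sphere 0 1 \<in> sets sphere_measure"
    using measurable_sets[OF gs A] by simp
  have vimage: "{x \<in> ball 0 1 - {0}. x /\<^sub>R norm x \<in> g -` A \<inter> sphere 0 1} = g -` S"
  proof (rule set_eqI)
    fix x
    have "g x = 0 \<longleftrightarrow> x = 0"
      using norm_g[of x] by (metis norm_eq_zero)
    moreover have "g (x /\<^sub>R norm x) = g x /\<^sub>R norm (g x)"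
      unfolding norm_g by (rule linear_scale[OF lin])
    moreover have "g x \<in> ball 0 1 \<longleftrightarrow> x \<in> ball 0 1"
      unfolding mem_ball_0 norm_g ..
    moreover have "x /\<^sub>R norm x \<in> sphere 0 1" if "x \<noteq> 0"
      using that by simp
    ultimately show "x \<in> {x \<in> ball 0 1 - {0}. x /\<^sub>R norm x \<in> g -` A \<inter> sphere 0 1} \<longleftrightarrow> x \<in> g -` S"
      unfolding S_def mem_Collect_eq vimage_eq Diff_iff Int_iff singleton_iff
      by (cases "x = 0") simp_all
  qed
  have "emeasure (distr lborel borel g) S = emeasure lborel (g -` S)"
    using S gm by (subst emeasure_distr) auto
  then have "emeasure lborel (g -` S) = emeasure lborel S"
    unfolding distr_lborel_orthogonal[OF g] by (rule sym)
  moreover have "emeasure (distr sphere_measure sphere_measure g) A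
      = emeasure sphere_measure (g -` A \<inter> sphere 0 1)"
    by (simp add: emeasure_distr[OF gs A])
  ultimately show "emeasure (distr sphere_measure sphere_measure g) A = emeasure sphere_measure A"
    unfolding emeasure_sphere_measure[OF A] emeasure_sphere_measure[OF gA] vimage S_def[symmetric]
    by simp
qed simp

section \<open>Gegenbauer polynomials\<close>

text \<open>
  For \<open>\<nu> = 0\<close> the condition on \<open>[-1, 1]\<close> determines the polynomial on the whole real line.
\<close>

definition is_gegenbauer :: "real \<Rightarrow> (nat \<Rightarrow> real poly) \<Rightarrow> bool"
  where "is_gegenbauer \<nu> C \<longleftrightarrow>
    (if \<nu> = 0 then \<forall>t. \<forall>x\<in>{-1..1}. poly (C t) x = cos (real t * arccos x)
     else \<forall>x. (\<lambda>r. (1 - 2 * x * r + r\<^sup>2) powr (-\<nu>)) has_fps_expansion Abs_fps (\<lambda>t. poly (C t) x))"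

definition gegenbauer :: "real \<Rightarrow> nat \<Rightarrow> real poly"
  where "gegenbauer \<nu> = (THE C. is_gegenbauer \<nu> C)"

lemma real_has_fps_expansion_unique:
  fixes F G :: "real fps"
  assumes "f has_fps_expansion F" "f has_fps_expansion G"
  shows "F = G"
proof (rule ccontr)
  assume neq: "F \<noteq> G"
  define D where "D = F - G"
  have "(\<lambda>x. f x - f x) has_fps_expansion D"
    unfolding D_def by (rule has_fps_expansion_diff[OF assms])
  then have D: "(\<lambda>x. 0) has_fps_expansion D"
    by simp
  then have "fps_conv_radius D > 0" and ev: "eventually (\<lambda>z. eval_fps D z = 0) (nhds 0)"
    by (auto simp: has_fps_expansion_def)
  then obtain r where r: "r > 0" "ereal r < fps_conv_radius D"
    using ereal_dense2[of 0 "fps_conv_radius D"] by auto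
  have sm: "(\<lambda>n. fps_nth D n * (x - 0) ^ n) sums eval_fps D x" if "norm (x - 0) < r" for x
    using that r less_trans[of "ereal \<bar>x\<bar>" "ereal r"] sums_eval_fps[of x D] by simp
  have D0: "eval_fps D 0 = 0"
    using ev by (rule eventually_nhds_x_imp_x)
  obtain m where m: "fps_nth D m \<noteq> 0"
    using neq by (auto simp: D_def fps_eq_iff)
  have "m > 0"
    using D0 m by (cases m) (auto simp: eval_fps_at_0)
  obtain s where s: "s > 0" "\<And>z. z \<in> cball 0 s - {0} \<Longrightarrow> eval_fps D z \<noteq> 0"
    using powser_0_nonzero[OF r(1) sm D0 m \<open>m > 0\<close>] by blast
  obtain e where e: "e > 0" "\<And>z. dist z 0 < e \<Longrightarrow> eval_fps D z = 0"
    using ev unfolding eventually_nhds_metric by blast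
  show False
  proof -
    define z where "z = min s (e / 2)"
    have "z > 0" "z \<le> s" "z < e"
      using s(1) e(1) by (auto simp: z_def)
    then show False
      using s(2)[of z] e(2)[of z] by simp
  qed
qed

lemma ex1_gegenbauer: "\<exists>!C. is_gegenbauer \<nu> C"
proof (cases "\<nu> = 0")
  case True
  have "\<exists>p. \<forall>x\<in>{-1..1}. poly p x = cos (real t * arccos x)" for t
  proof (induction t rule: induct_nat_012)
    case 0
    show ?case by (intro exI[of _ 1]) simp
  next
    case 1
    show ?case by (intro exI[of _ "[:0, 1:]"]) simp
  next
    case (ge2 t)
    then obtain p q where p: "\<forall>x\<in>{-1..1}. poly p x = cos (real t * arccos x)"
      and q: "\<forall>x\<in>{-1..1}. poly q x = cos (real (Suc t) * arccos x)"
      by blast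
    have "poly ([:0, 2:] * q - p) x = cos (real (Suc (Suc t)) * arccos x)" if x: "x \<in> {-1..1}" for x
    proof -
      define y where "y = arccos x"
      have y: "cos y = x"
        using x by (simp add: y_def)
      have "cos (real (Suc (Suc t)) * y) + cos (real t * y) = 2 * cos y * cos (real (Suc t) * y)"
        using cos_add[of "real (Suc t) * y" y] cos_diff[of "real (Suc t) * y" y]
        by (simp add: algebra_simps)
      with p q x y show ?thesis
        by (simp add: y_def)
    qed
    then show ?case by blast
  qed
  then obtain C where C: "\<And>t. \<forall>x\<in>{-1..1}. poly (C t) x = cos (real t * arccos x)"
    by metis
  show ?thesis
  proof (rule ex1I[of _ C])
    show "is_gegenbauer \<nu> C"
      using C True by (simp add: is_gegenbauer_def)
    fix E
    assume "is_gegenbauer \<nu> E"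
    with C True have "poly (E t - C t) x = 0" if "x \<in> {-1..1}" for t x
      using that by (simp add: is_gegenbauer_def)
    then have sub: "{-1..1} \<subseteq> {x. poly (E t - C t) x = 0}" for t
      by blast
    have "E t - C t = 0" for t
    proof (rule ccontr)
      assume "E t - C t \<noteq> 0"
      then have "finite {-1..1::real}"
        using finite_subset[OF sub poly_roots_finite] by blast
      then show False
        by (simp add: infinite_Icc)
    qed
    then show "E = C"
      by auto
  qed
next
  case False
  define Gp :: "real poly fps" where "Gp = fps_X ^ 2 - fps_const [:0, 2:] * fps_X"
  define Gc :: "real \<Rightarrow> complex fps"
    where "Gc x = fps_X ^ 2 - fps_const (of_real (2 * x)) * fps_X" for x
  define C where "C t = (\<Sum>i=0..t. smult ((-\<nu>) gchoose i) (fps_nth (Gp ^ i) t))" for t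
  have Gc_nth: "fps_nth (Gc x ^ i) t = of_real (poly (fps_nth (Gp ^ i) t) x)" for x i t
  proof (induction i arbitrary: t)
    case 0
    show ?case by simp
  next
    case (Suc i)
    have "fps_nth (Gc x) k = of_real (poly (fps_nth Gp k) x)" for k
      by (simp add: Gc_def Gp_def fps_X_power_nth fps_X_nth)
    with Suc show ?case
      by (simp add: fps_mult_nth poly_sum)
  qed
  have coeff: "fps_nth (fps_binomial (of_real (-\<nu>)) oo Gc x) t = of_real (poly (C t) x)" for x t
  proof -
    have gchoose: "(complex_of_real (-\<nu>) gchoose i) = of_real ((-\<nu>) gchoose i)" for i
      by (simp add: gbinomial_prod_rev)
    show ?thesis
      unfolding fps_compose_nth C_def poly_sum Gc_nth fps_binomial_nth gchoose by simp
  qed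
  have expansion: "(\<lambda>r. (1 - 2 * x * r + r\<^sup>2) powr (-\<nu>)) has_fps_expansion Abs_fps (\<lambda>t. poly (C t) x)" for x
  proof -
    define F where "F = fps_binomial (of_real (-\<nu>)) oo Gc x"
    define H where "H = Abs_fps (\<lambda>t. poly (C t) x)"
    have G: "(\<lambda>z. z ^ 2 - of_real (2 * x) * z) has_fps_expansion Gc x"
      unfolding Gc_def by (intro fps_expansion_intros)
    have "((\<lambda>z. (1 + z) powr of_real (-\<nu>)) \<circ> (\<lambda>z. z ^ 2 - of_real (2 * x) * z)) has_fps_expansion F"
      unfolding F_def
      by (intro has_fps_expansion_compose has_fps_expansion_binomial_complex G) (simp add: Gc_def)
    then have F: "fps_conv_radius F > 0"
      and evF: "eventually (\<lambda>z. eval_fps F z = (1 + (z ^ 2 - of_real (2 * x) * z)) powr of_real (-\<nu>)) (nhds 0)"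
      by (auto simp: has_fps_expansion_def)
    have nth: "fps_nth F t = of_real (fps_nth H t)" for t
      unfolding F_def H_def coeff by simp
    have radius: "fps_conv_radius H = fps_conv_radius F"
      by (simp add: fps_conv_radius_def conv_radius_def nth)
    have tends: "filterlim complex_of_real (nhds 0) (nhds 0)"
      using tendsto_of_real[of "\<lambda>x. x" "0::real" "nhds 0"] by (simp add: filterlim_ident)
    have ev1: "eventually (\<lambda>r. eval_fps F (of_real r)
        = (1 + (of_real r ^ 2 - of_real (2 * x) * of_real r)) powr of_real (-\<nu>)) (nhds (0::real))"
      using evF tends by (rule eventually_compose_filterlim)
    have "((\<lambda>r. 1 - 2 * x * r + r\<^sup>2) \<longlongrightarrow> 1 - 2 * x * 0 + 0\<^sup>2) (nhds (0::real))"
      by (intro tendsto_intros filterlim_ident)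
    then have ev2: "eventually (\<lambda>r. 1 - 2 * x * r + r\<^sup>2 > 0) (nhds (0::real))"
      by (rule order_tendstoD) simp
    have ev3: "eventually (\<lambda>r. r \<in> eball (0::real) (fps_conv_radius H)) (nhds 0)"
      using F radius by (intro eventually_nhds_in_open) (auto simp: zero_ereal_def)
    have "eventually (\<lambda>r. eval_fps H r = (1 - 2 * x * r + r\<^sup>2) powr (-\<nu>)) (nhds 0)"
      using ev1 ev2 ev3
    proof eventually_elim
      case (elim r)
      have "(\<lambda>t. complex_of_real (fps_nth H t * r ^ t)) sums of_real (eval_fps H r)"
        using elim(3) by (intro sums_of_real sums_eval_fps) simp
      moreover have "(\<lambda>t. fps_nth F t * of_real r ^ t) sums eval_fps F (of_real r)"
        using elim(3) radius by (intro sums_eval_fps) simp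
      ultimately have "of_real (eval_fps H r) = eval_fps F (of_real r)"
        by (simp add: nth sums_unique2)
      also have "\<dots> = of_real (1 - 2 * x * r + r\<^sup>2) powr of_real (-\<nu>)"
        using elim(1) by (simp add: algebra_simps)
      also have "\<dots> = of_real ((1 - 2 * x * r + r\<^sup>2) powr (-\<nu>))"
        using elim(2) by (intro powr_of_real) simp
      finally show ?case
        by (simp only: of_real_eq_iff)
    qed
    then show ?thesis
      using F radius by (simp add: has_fps_expansion_def H_def)
  qed
  show ?thesis
  proof (rule ex1I[of _ C])
    show "is_gegenbauer \<nu> C"
      using expansion False by (simp add: is_gegenbauer_def)
    fix E
    assume "is_gegenbauer \<nu> E"
    with False have "Abs_fps (\<lambda>t. poly (E t) x) = Abs_fps (\<lambda>t. poly (C t) x)" for x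
      using expansion[of x] real_has_fps_expansion_unique by (auto simp: is_gegenbauer_def)
    then have "poly (E t) x = poly (C t) x" for t x
      by (metis fps_nth_Abs_fps)
    then show "E = C"
      by (intro ext) (metis poly_eq_poly_eq_iff ext)
  qed
qed

lemma is_gegenbauer_gegenbauer: "is_gegenbauer \<nu> (gegenbauer \<nu>)"
  unfolding gegenbauer_def by (rule theI'[OF ex1_gegenbauer])

text \<open>
  The guard is needed because for \<open>t = 1\<close> the lower entry \<open>t - 2\<close> is negative and the
  binomial coefficient is 0, whereas subtraction on \<^typ>\<open>nat\<close> truncates.
\<close>

definition Q_at_one :: "nat \<Rightarrow> nat \<Rightarrow> real"
  where "Q_at_one n t =
    real ((n + t - 1) choose t) - (if t < 2 then 0 else real ((n + t - 3) choose (t - 2)))"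

definition Q_poly :: "nat \<Rightarrow> nat \<Rightarrow> real poly"
  where "Q_poly n t = (let C = gegenbauer ((real n - 2) / 2) t in smult (Q_at_one n t / poly C 1) C)"

lemma gegenbauer_at_1_pos: "\<nu> \<ge> 0 \<Longrightarrow> poly (gegenbauer \<nu> t) 1 > 0"
proof (cases "\<nu> = 0")
  case True
  then show ?thesis
    using is_gegenbauer_gegenbauer[of \<nu>] by (simp add: is_gegenbauer_def)
next
  case False
  assume "\<nu> \<ge> 0"
  with False have \<nu>: "\<nu> > 0"
    by simp
  define H where "H = Abs_fps (\<lambda>n. (2 * \<nu> + real n - 1) gchoose n)"
  have sums: "(\<lambda>n. fps_nth H n * r ^ n) sums ((1 - 2 * 1 * r + r\<^sup>2) powr (-\<nu>))" if "\<bar>r\<bar> < 1" for r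
  proof -
    have "(\<lambda>n. ((-(2 * \<nu>)) gchoose n) * (- r) ^ n) sums ((1 + - r) powr (-(2 * \<nu>)))"
      using that by (intro gen_binomial_real) simp
    also have "(\<lambda>n. ((-(2 * \<nu>)) gchoose n) * (- r) ^ n) = (\<lambda>n. fps_nth H n * r ^ n)"
    proof
      fix n
      have "((-1) ^ n * (-r) ^ n) = r ^ n"
        by (simp flip: power_mult_distrib)
      then show "((-(2 * \<nu>)) gchoose n) * (- r) ^ n = fps_nth H n * r ^ n"
        unfolding gbinomial_minus by (simp add: H_def mult_ac)
    qed
    also have "(1 + - r) powr (-(2 * \<nu>)) = ((1 - r) powr 2) powr (-\<nu>)"
      by (simp add: powr_powr)
    also have "(1 - r) powr 2 = 1 - 2 * 1 * r + r\<^sup>2"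
      using that by (simp add: power2_eq_square algebra_simps)
    finally show ?thesis .
  qed
  have "conv_radius (fps_nth H) \<ge> 1"
  proof (rule conv_radius_geI_ex)
    fix r :: real
    assume "0 < r" "ereal r < 1"
    then have "\<bar>r\<bar> < 1" by simp
    then show "\<exists>z. norm z = r \<and> summable (\<lambda>n. fps_nth H n * z ^ n)"
      using sums_summable[OF sums] \<open>0 < r\<close> by (intro exI[of _ r]) simp
  qed
  then have "fps_conv_radius H > 0"
    unfolding fps_conv_radius_def by (rule less_le_trans[rotated]) simp
  moreover have "eventually (\<lambda>r. eval_fps H r = (1 - 2 * 1 * r + r\<^sup>2) powr (-\<nu>)) (nhds 0)"
    using eventually_nhds_in_open[of "ball (0::real) 1" 0]
    by (auto elim!: eventually_mono simp: eval_fps_def sums_unique[OF sums, symmetric])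
  ultimately have "(\<lambda>r. (1 - 2 * 1 * r + r\<^sup>2) powr (-\<nu>)) has_fps_expansion H"
    by (simp add: has_fps_expansion_def)
  moreover have "(\<lambda>r. (1 - 2 * 1 * r + r\<^sup>2) powr (-\<nu>)) has_fps_expansion Abs_fps (\<lambda>t. poly (gegenbauer \<nu> t) 1)"
    using is_gegenbauer_gegenbauer[of \<nu>] False unfolding is_gegenbauer_def by presburger
  ultimately have "fps_nth (Abs_fps (\<lambda>t. poly (gegenbauer \<nu> t) 1)) t = fps_nth H t"
    using real_has_fps_expansion_unique by metis
  also have "\<dots> > 0"
    using \<nu> by (simp add: H_def gbinomial_pochhammer' pochhammer_pos)
  finally show ?thesis
    by simp
qed

lemma Q_poly_at_1: "n \<ge> 2 \<Longrightarrow> poly (Q_poly n t) 1 = Q_at_one n t"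
  using gegenbauer_at_1_pos[of "(real n - 2) / 2" t] by (simp add: Q_poly_def Let_def)

section \<open>Designs\<close>

definition spherical_design :: "nat \<Rightarrow> 'a::euclidean_space set \<Rightarrow> bool"
  where "spherical_design t X \<longleftrightarrow> finite X \<and> X \<noteq> {} \<and> X \<subseteq> sphere 0 1 \<and>
    (\<forall>f. polynomial_of_degree_le t f \<longrightarrow>
      (LINT x|sphere_measure. f x) / measure (sphere_measure :: 'a measure) (sphere 0 1)
        = (\<Sum>x\<in>X. f x) / real (card X))"

definition harmonic_index_design :: "nat \<Rightarrow> 'a::euclidean_space set \<Rightarrow> bool"
  where "harmonic_index_design t X \<longleftrightarrow> finite X \<and> X \<noteq> {} \<and> X \<subseteq> sphere 0 1 \<and>
    (\<forall>f\<in>Harm t. (\<Sum>x\<in>X. f x) = 0)"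

end

theory Submission
  imports Defs
begin

text \<open>
  Write a harmonic \<open>f\<close> as a sum of monomials \<open>c \<alpha> * z ^ (t - k) * x\<^sup>\<alpha>\<close> with \<open>\<bar>\<alpha>\<bar> = k\<close>, and let
  \<open>a k\<close> be the sum of \<open>c \<alpha> * M \<alpha>\<close> over the terms of degree \<open>k\<close> in \<open>x\<close>, where \<open>M \<alpha>\<close> is the
  integral of \<open>x\<^sup>\<alpha>\<close> over the unit sphere of \<open>m\<close>-dimensional space, \<open>m = n - 1\<close>.
  Rotation invariance shows that the integral of the Laplacian of \<open>x\<^sup>\<alpha>\<close> is \<open>k * (k + m - 2) * M \<alpha>\<close>,
  so integrating \<open>\<Delta> f = 0\<close> over \<open>x\<close> gives
  \<open>(k + 2) * (k + m) * a (k + 2) = - (t - k) * (t - k - 1) * a k\<close>, while \<open>a k = 0\<close> for odd \<open>k\<close>.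
  Since \<open>X\<close> is a \<open>t\<close>-design, the sum of \<open>f\<close> over \<open>X'\<close> is a multiple of the sum of
  \<open>a k * r ^ (t - k) * sqrt (1 - r\<^sup>2) ^ k\<close>, which by this recurrence is \<open>a 0\<close> times a polynomial in
  \<open>r\<close> depending only on \<open>m\<close> and \<open>t\<close>. The latter satisfies the three-term recurrence of
  the Gegenbauer polynomials, hence is a nonzero multiple of \<open>Q\<close> and vanishes at \<open>r\<close>.
\<close>

section \<open>Zonal polynomials\<close>

definition falling_product :: "nat \<Rightarrow> nat \<Rightarrow> real"
  where "falling_product t k = (\<Prod>i<k. real t - real i)"

lemma falling_product_eq_0: "t < k \<Longrightarrow> falling_product t k = 0"
  by (auto simp: falling_product_def intro!: bexI[of _ t])

lemma falling_product_nonneg: "falling_product t k \<ge> 0"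
proof (cases "t < k")
  case True
  then show ?thesis by (simp add: falling_product_eq_0)
next
  case False
  then show ?thesis by (auto simp: falling_product_def intro!: prod_nonneg)
qed

lemma falling_product_Suc: "falling_product t (Suc k) = falling_product t k * (real t - real k)"
  by (simp add: falling_product_def)

lemma falling_product_Suc_Suc:
  "falling_product (Suc t) (Suc k) = (real t + 1) * falling_product t k"
  unfolding falling_product_def by (subst prod.lessThan_Suc_shift) simp

text \<open>
  These are the coefficients of the polynomials \<open>\<Sum>j. b j * z ^ (t - 2 * j) * \<rho> ^ (2 * j)\<close> with
  \<open>b 0 = 1\<close> that, for \<open>\<rho>\<close> the Euclidean norm on \<open>m\<close>-dimensional space, are harmonic on
  \<open>m + 1\<close>-dimensional space; below \<open>w\<close> stands for \<open>\<rho>\<^sup>2\<close>.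
  For \<open>t < 2 * j\<close> the falling product vanishes, so the truncated exponent does no harm.
\<close>

definition zonal_coeff :: "real \<Rightarrow> nat \<Rightarrow> nat \<Rightarrow> real"
  where "zonal_coeff m t j =
    (-1) ^ j * falling_product t (2 * j) / (\<Prod>i<j. (2 * real i + 2) * (2 * real i + m))"

definition zonal :: "real \<Rightarrow> nat \<Rightarrow> real \<Rightarrow> real \<Rightarrow> real"
  where "zonal m t z w = (\<Sum>j\<le>t. zonal_coeff m t j * z ^ (t - 2 * j) * w ^ j)"

lemma zonal_coeff_0 [simp]: "zonal_coeff m t 0 = 1"
  by (simp add: zonal_coeff_def falling_product_def)

lemma zonal_coeff_eq_0: "t < 2 * j \<Longrightarrow> zonal_coeff m t j = 0"
  by (simp add: zonal_coeff_def falling_product_eq_0)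

text \<open>This is the relation that harmonicity forces between the coefficients of degrees
  \<open>2 * j\<close> and \<open>2 * j + 2\<close>; the averages of a harmonic polynomial are
  matched against it below. The assumption keeps the denominators nonzero.\<close>

lemma zonal_coeff_Suc:
  assumes "m > 0"
  shows "(2 * real j + 2) * (2 * real j + m) * zonal_coeff m t (Suc j)
    = - ((real t - 2 * real j) * (real t - 2 * real j - 1)) * zonal_coeff m t j"
proof -
  define B where "B = (\<Prod>i<j. (2 * real i + 2) * (2 * real i + m))"
  have "B \<noteq> 0" "2 * real j + 2 \<noteq> 0" "2 * real j + m \<noteq> 0"
    using assms by (auto simp: B_def add_nonneg_eq_0_iff intro!: prod_pos less_imp_neq[symmetric] mult_pos_pos add_nonneg_pos)
  then show ?thesis
    by (simp add: zonal_coeff_def falling_product_Suc B_def[symmetric] divide_simps)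
qed

text \<open>Coefficients with \<open>2 * j > t\<close> vanish, so the sums for \<open>t\<close>,
  \<open>t + 1\<close> and \<open>t + 2\<close> can share an upper limit.\<close>

lemma zonal_eq_sum:
  assumes "t \<le> N"
  shows "zonal m t z w = (\<Sum>j\<le>N. zonal_coeff m t j * z ^ (t - 2 * j) * w ^ j)"
  unfolding zonal_def
  using assms by (intro sum.mono_neutral_left) (auto simp: zonal_coeff_eq_0)

text \<open>This is the coefficient of \<open>w ^ Suc j\<close> in \<open>zonal_recurrence\<close>.
  All four zonal coefficients are the common factor \<open>D * F\<close> times polynomials in
  \<open>t\<close>, \<open>j\<close> and \<open>\<nu>\<close>, which leaves a polynomial
  identity.\<close>

lemma zonal_coeff_recurrence:
  assumes "\<nu> \<ge> 0"
  shows "(real t + 1 + 2 * \<nu>) * zonal_coeff (2 * \<nu> + 1) (t + 2) (Suc j)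
    = 2 * (real t + 1 + \<nu>) * zonal_coeff (2 * \<nu> + 1) (t + 1) (Suc j)
      - (real t + 1) * (zonal_coeff (2 * \<nu> + 1) t (Suc j) + zonal_coeff (2 * \<nu> + 1) t j)"
proof -
  define B where "B = (\<Prod>i<j. (2 * real i + 2) * (2 * real i + (2 * \<nu> + 1)))"
  define F where "F = falling_product t (2 * j)"
  have nz: "B \<noteq> 0" "2 * real j + 2 \<noteq> 0" "2 * real j + (2 * \<nu> + 1) \<noteq> 0"
    using assms by (auto simp: B_def intro!: prod_pos less_imp_neq[symmetric] mult_pos_pos)
  define D where "D = (-1) ^ j / (B * ((2 * real j + 2) * (2 * real j + (2 * \<nu> + 1))))"
  have 0: "zonal_coeff (2 * \<nu> + 1) t j = D * F * ((2 * real j + 2) * (2 * real j + (2 * \<nu> + 1)))"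
    using nz by (simp add: zonal_coeff_def D_def B_def[symmetric] F_def)
  have 1: "zonal_coeff (2 * \<nu> + 1) t' (Suc j) = - D * falling_product t' (Suc (Suc (2 * j)))" for t'
    unfolding zonal_coeff_def D_def prod.lessThan_Suc B_def[symmetric] by simp
  have F1: "falling_product t (Suc (2 * j)) = F * (real t - 2 * real j)"
    by (simp add: falling_product_Suc F_def)
  have 2: "falling_product t (Suc (Suc (2 * j))) = F * (real t - 2 * real j) * (real t - 2 * real j - 1)"
    "falling_product (t + 1) (Suc (Suc (2 * j))) = (real t + 1) * F * (real t - 2 * real j)"
    "falling_product (t + 2) (Suc (Suc (2 * j))) = (real t + 2) * (real t + 1) * F"
    unfolding falling_product_Suc[of t "Suc (2 * j)"] F1 falling_product_Suc_Suc Suc_eq_plus1[symmetric] add_2_eq_Suc'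
    by (simp_all add: F_def algebra_simps)
  show ?thesis
    unfolding 0 1 2 by (simp add: algebra_simps)
qed

text \<open>
  The factor \<open>z\<^sup>2 + w\<close>, which is 1 on the sphere, makes the three-term recurrence of the
  Gegenbauer polynomials homogeneous, so that it can be checked coefficient by coefficient.
\<close>

lemma zonal_recurrence:
  assumes "\<nu> \<ge> 0"
  shows "(real t + 1 + 2 * \<nu>) * zonal (2 * \<nu> + 1) (t + 2) z w
    = 2 * (real t + 1 + \<nu>) * z * zonal (2 * \<nu> + 1) (t + 1) z w
      - (real t + 1) * (z\<^sup>2 + w) * zonal (2 * \<nu> + 1) t z w"
proof -
  let ?b = "zonal_coeff (2 * \<nu> + 1)"
  define N where "N = t + 1"
  have N: "t + 2 \<le> Suc N" "t + 1 \<le> Suc N" "t \<le> Suc N" "t \<le> N"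
    by (simp_all add: N_def)
  have split: "(\<Sum>j\<le>Suc N. ?b u j * z ^ (t + 2 - 2 * j) * w ^ j)
      = z ^ (t + 2) + (\<Sum>j\<le>N. ?b u (Suc j) * z ^ (t - 2 * j) * w ^ Suc j)" for u
    by (subst sum.atMost_Suc_shift) simp
  \<comment> \<open>The truncated exponents disagree only for \<open>2 * j > t + 1\<close>, where
    the coefficient is 0.\<close>
  have shift1: "z * (?b (t + 1) j * z ^ (t + 1 - 2 * j) * w ^ j) = ?b (t + 1) j * z ^ (t + 2 - 2 * j) * w ^ j" for j
  proof (cases "2 * j \<le> t + 1")
    case True
    then have "t + 2 - 2 * j = Suc (t + 1 - 2 * j)"
      by simp
    then show ?thesis by (simp only: power_Suc mult_ac)
  next
    case False
    then show ?thesis by (simp add: zonal_coeff_eq_0)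
  qed
  have shift0: "z\<^sup>2 * (?b t j * z ^ (t - 2 * j) * w ^ j) = ?b t j * z ^ (t + 2 - 2 * j) * w ^ j" for j
  proof (cases "2 * j \<le> t")
    case True
    then have "t + 2 - 2 * j = Suc (Suc (t - 2 * j))"
      by simp
    then show ?thesis by (simp only: power_Suc power2_eq_square mult_ac)
  next
    case False
    then show ?thesis by (simp add: zonal_coeff_eq_0)
  qed
  have 2: "zonal (2 * \<nu> + 1) (t + 2) z w = z ^ (t + 2) + (\<Sum>j\<le>N. ?b (t + 2) (Suc j) * z ^ (t - 2 * j) * w ^ Suc j)"
    unfolding zonal_eq_sum[OF N(1)] split ..
  have 1: "z * zonal (2 * \<nu> + 1) (t + 1) z w
      = z ^ (t + 2) + (\<Sum>j\<le>N. ?b (t + 1) (Suc j) * z ^ (t - 2 * j) * w ^ Suc j)"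
    unfolding zonal_eq_sum[OF N(2)] sum_distrib_left[of z] shift1 split ..
  have 0: "z\<^sup>2 * zonal (2 * \<nu> + 1) t z w
      = z ^ (t + 2) + (\<Sum>j\<le>N. ?b t (Suc j) * z ^ (t - 2 * j) * w ^ Suc j)"
    unfolding zonal_eq_sum[OF N(3)] sum_distrib_left[of "z\<^sup>2"] shift0 split ..
  have w0: "w * zonal (2 * \<nu> + 1) t z w = (\<Sum>j\<le>N. ?b t j * z ^ (t - 2 * j) * w ^ Suc j)"
    unfolding zonal_eq_sum[OF N(4)] sum_distrib_left[of w] power_Suc by (simp only: mult_ac)
  have "(real t + 1 + 2 * \<nu>) * (\<Sum>j\<le>N. ?b (t + 2) (Suc j) * z ^ (t - 2 * j) * w ^ Suc j)
      = 2 * (real t + 1 + \<nu>) * (\<Sum>j\<le>N. ?b (t + 1) (Suc j) * z ^ (t - 2 * j) * w ^ Suc j)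
      - (real t + 1) * ((\<Sum>j\<le>N. ?b t (Suc j) * z ^ (t - 2 * j) * w ^ Suc j)
         + (\<Sum>j\<le>N. ?b t j * z ^ (t - 2 * j) * w ^ Suc j))"
    unfolding sum_distrib_left sum.distrib[symmetric] sum_subtractf[symmetric]
  proof (intro sum.cong refl)
    fix j
    show "(real t + 1 + 2 * \<nu>) * (?b (t + 2) (Suc j) * z ^ (t - 2 * j) * w ^ Suc j)
      = 2 * (real t + 1 + \<nu>) * (?b (t + 1) (Suc j) * z ^ (t - 2 * j) * w ^ Suc j)
      - (real t + 1) * (?b t (Suc j) * z ^ (t - 2 * j) * w ^ Suc j + ?b t j * z ^ (t - 2 * j) * w ^ Suc j)"
      using arg_cong[OF zonal_coeff_recurrence[OF assms, of t j], of "\<lambda>u. u * (z ^ (t - 2 * j) * w ^ Suc j)"]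
      by (simp add: algebra_simps)
  qed
  \<comment> \<open>The split-off terms \<open>z ^ (t + 2)\<close> balance because
    \<open>t + 1 + 2 * \<nu> = 2 * (t + 1 + \<nu>) - (t + 1)\<close>.\<close>
  then show ?thesis
    unfolding distrib_right[of "z\<^sup>2"] mult.assoc[of _ z] mult.assoc[of _ "z\<^sup>2 + w"] 0 1 2 w0
    by (simp only: algebra_simps)
qed

text \<open>
  For \<open>z \<ge> 1\<close> the sign of \<open>(1 - z\<^sup>2) ^ j\<close> cancels that of the coefficient, so every term is
  nonnegative. This confines the real roots to the open interval \<open>(-1, 1)\<close>.
\<close>

lemma zonal_pos:
  assumes "m > 0" "z \<ge> 1"
  shows "zonal m t z (1 - z\<^sup>2) > 0"
proof -
  have "0 \<le> zonal_coeff m t j * z ^ (t - 2 * j) * (1 - z\<^sup>2) ^ j" for j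
  proof -
    have "(1 - z\<^sup>2) ^ j = (-1) ^ j * (z\<^sup>2 - 1) ^ j"
      by (simp flip: power_mult_distrib)
    moreover have "((-1) ^ j * (-1) ^ j :: real) = 1"
      by (simp flip: power_mult_distrib)
    ultimately have "zonal_coeff m t j * z ^ (t - 2 * j) * (1 - z\<^sup>2) ^ j =
      falling_product t (2 * j) / (\<Prod>i<j. (2 * real i + 2) * (2 * real i + m)) * z ^ (t - 2 * j) * (z\<^sup>2 - 1) ^ j"
      by (simp add: zonal_coeff_def)
    also have "\<dots> \<ge> 0"
      using assms by (intro mult_nonneg_nonneg divide_nonneg_nonneg falling_product_nonneg prod_nonneg) auto
    finally show ?thesis .
  qed
  \<comment> \<open>The term for \<open>j = 0\<close> is \<open>z ^ t\<close>, which makes the sum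
    strictly positive.\<close>
  then have "zonal_coeff m t 0 * z ^ (t - 2 * 0) * (1 - z\<^sup>2) ^ 0 \<le> zonal m t z (1 - z\<^sup>2)"
    unfolding zonal_def by (intro member_le_sum) auto
  moreover have "z ^ t > 0"
    using assms by simp
  ultimately show ?thesis
    by simp
qed

text \<open>Every exponent \<open>t - 2 * j\<close> with nonzero coefficient has the parity of
  \<open>t\<close>.\<close>

lemma zonal_minus: "zonal m t (- z) w = (-1) ^ t * zonal m t z w"
  unfolding zonal_def sum_distrib_left
proof (intro sum.cong refl)
  fix j
  show "zonal_coeff m t j * (- z) ^ (t - 2 * j) * w ^ j = (-1) ^ t * (zonal_coeff m t j * z ^ (t - 2 * j) * w ^ j)"
  proof (cases "2 * j \<le> t")
    case True
    then obtain i where "t = i + 2 * j"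
      by (metis le_add_diff_inverse2)
    then show ?thesis
      by (simp add: power_add power_mult power_minus[of z])
  next
    case False
    then show ?thesis by (simp add: zonal_coeff_eq_0)
  qed
qed

text \<open>This will force a root \<open>r\<close> to satisfy \<open>\<bar>r\<bar> < 1\<close>, so
  that the lifted points do not collapse into one.\<close>

lemma zonal_nonzero:
  assumes "m > 0" "\<bar>z\<bar> \<ge> 1"
  shows "zonal m t z (1 - z\<^sup>2) \<noteq> 0"
proof (cases "z \<ge> 0")
  case True
  then show ?thesis
    using zonal_pos[of m z t] assms by simp
next
  case False
  then show ?thesis
    using zonal_pos[of m "- z" t] zonal_minus[of m t z] assms by fastforce
qed

section \<open>Gegenbauer polynomials as zonal polynomials\<close>

text \<open>The generating function satisfies
  \<open>(1 - 2 * x * r + r ^ 2) * f' = 2 * \<nu> * (x - r) * f\<close>; the claims follow by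
  comparing coefficients of the power series in \<open>r\<close>.\<close>

lemma gegenbauer_recurrence:
  assumes "\<nu> \<noteq> 0"
  shows "poly (gegenbauer \<nu> 0) x = 1"
    and "poly (gegenbauer \<nu> 1) x = 2 * \<nu> * x"
    and "(real t + 2) * poly (gegenbauer \<nu> (t + 2)) x
      = 2 * (real t + 1 + \<nu>) * x * poly (gegenbauer \<nu> (t + 1)) x - (real t + 2 * \<nu>) * poly (gegenbauer \<nu> t) x"
proof -
  define F where "F = Abs_fps (\<lambda>t. poly (gegenbauer \<nu> t) x)"
  define f where "f r = (1 - 2 * x * r + r\<^sup>2) powr (-\<nu>)" for r
  have f: "f has_fps_expansion F"
    using is_gegenbauer_gegenbauer[of \<nu>] assms
    unfolding is_gegenbauer_def F_def f_def by auto
  have "((\<lambda>r. 1 - 2 * x * r + r\<^sup>2) \<longlongrightarrow> 1 - 2 * x * 0 + 0\<^sup>2) (nhds (0::real))"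
    by (intro tendsto_intros filterlim_ident)
  then have pos: "eventually (\<lambda>r. 1 - 2 * x * r + r\<^sup>2 > 0) (nhds (0::real))"
    by (rule order_tendstoD) simp
  have ev: "eventually (\<lambda>r. (1 - 2 * x * r + r ^ 2) * deriv f r = (2 * \<nu> * x - 2 * \<nu> * r) * f r) (nhds 0)"
    using pos
  proof eventually_elim
    case (elim r)
    have "(f has_real_derivative -\<nu> * (1 - 2 * x * r + r\<^sup>2) powr (-\<nu> - 1) * (2 * r - 2 * x)) (at r)"
      unfolding f_def[abs_def] using elim by (auto intro!: derivative_eq_intros)
    then have "deriv f r = -\<nu> * (1 - 2 * x * r + r\<^sup>2) powr (-\<nu> - 1) * (2 * r - 2 * x)"
      by (rule DERIV_imp_deriv)
    moreover have "(1 - 2 * x * r + r\<^sup>2) * (1 - 2 * x * r + r\<^sup>2) powr (-\<nu> - 1) = f r"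
      using elim powr_add[of "1 - 2 * x * r + r\<^sup>2" 1 "-\<nu> - 1"] by (simp add: f_def)
    moreover have "D * (-\<nu> * E * (2 * r - 2 * x)) = (2 * \<nu> * x - 2 * \<nu> * r) * (D * E)" for D E :: real
      by (simp add: algebra_simps)
    ultimately show ?case
      by (simp only:)
  qed
  have L: "(\<lambda>r. (1 - 2 * x * r + r ^ 2) * deriv f r) has_fps_expansion
      (1 - fps_const (2 * x) * fps_X + fps_X ^ 2) * fps_deriv F"
    by (intro fps_expansion_intros f)
  have R: "(\<lambda>r. (2 * \<nu> * x - 2 * \<nu> * r) * f r) has_fps_expansion
      (fps_const (2 * \<nu> * x) - fps_const (2 * \<nu>) * fps_X) * F"
    by (intro fps_expansion_intros f)
  have eq: "(1 - fps_const (2 * x) * fps_X + fps_X ^ 2) * fps_deriv F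
      = (fps_const (2 * \<nu> * x) - fps_const (2 * \<nu>) * fps_X) * F"
    using iffD1[OF has_fps_expansion_cong[OF ev refl] L] R by (rule real_has_fps_expansion_unique)
  then have eq': "fps_deriv F - fps_const (2 * x) * (fps_X * fps_deriv F) + fps_X ^ 2 * fps_deriv F
      = fps_const (2 * \<nu> * x) * F - fps_const (2 * \<nu>) * (fps_X * F)"
    by (simp only: ring_distribs mult.assoc mult_1_left)
  have nth: "fps_nth (fps_deriv F - fps_const (2 * x) * (fps_X * fps_deriv F) + fps_X ^ 2 * fps_deriv F) k
      = fps_nth (fps_const (2 * \<nu> * x) * F - fps_const (2 * \<nu>) * (fps_X * F)) k" for k
    by (simp only: eq')
  have F_nth: "fps_nth F k = poly (gegenbauer \<nu> k) x" for k
    by (simp add: F_def)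
  have "f 0 = fps_nth F 0"
    using has_fps_expansion_imp_0_eq_fps_nth_0[OF f] by simp
  then show C0: "poly (gegenbauer \<nu> 0) x = 1"
    by (simp add: f_def F_nth)
  show "poly (gegenbauer \<nu> 1) x = 2 * \<nu> * x"
    using nth[of 0] C0 by (simp add: F_nth algebra_simps)
  show "(real t + 2) * poly (gegenbauer \<nu> (t + 2)) x
      = 2 * (real t + 1 + \<nu>) * x * poly (gegenbauer \<nu> (t + 1)) x - (real t + 2 * \<nu>) * poly (gegenbauer \<nu> t) x"
    \<comment> \<open>For \<open>t = 0\<close> the term \<open>fps_X ^ 2 * fps_deriv F\<close> has
      coefficient 0 at degree 1, in agreement with the general value \<open>t\<close> times the
      coefficient of \<open>F\<close> at \<open>t\<close>.\<close>
    using nth[of "Suc t"]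
    by (cases t; simp add: F_nth fps_X_power_mult_nth fps_X_mult_nth; simp add: algebra_simps)
qed


text \<open>On \<open>[-1, 1]\<close> these are the addition formulas for cosine. Polynomials that
  agree on an infinite set are equal, which extends them to every real \<open>x\<close>.\<close>

lemma gegenbauer_0_recurrence:
  shows "poly (gegenbauer 0 0) x = 1"
    and "poly (gegenbauer 0 1) x = x"
    and "poly (gegenbauer 0 (t + 2)) x = 2 * x * poly (gegenbauer 0 (t + 1)) x - poly (gegenbauer 0 t) x"
proof -
  have C: "poly (gegenbauer 0 t) y = cos (real t * arccos y)" if "y \<in> {-1..1}" for t y
    using is_gegenbauer_gegenbauer[of 0] that by (simp add: is_gegenbauer_def)
  have poly_eqI: "p = q" if "\<And>y. y \<in> {-1..1} \<Longrightarrow> poly p y = poly q y" for p q :: "real poly"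
  proof (rule ccontr)
    assume "p \<noteq> q"
    then have "finite {y. poly (p - q) y = 0}"
      by (intro poly_roots_finite) simp
    then have "finite {-1..1::real}"
      by (rule finite_subset[rotated]) (use that in auto)
    then show False
      by (simp add: infinite_Icc)
  qed
  have "gegenbauer 0 0 = 1" "gegenbauer 0 1 = [:0, 1:]"
    by (intro poly_eqI; simp add: C)+
  then show "poly (gegenbauer 0 0) x = 1" "poly (gegenbauer 0 1) x = x"
    by simp_all
  have "gegenbauer 0 (t + 2) = [:0, 2:] * gegenbauer 0 (t + 1) - gegenbauer 0 t"
  proof (rule poly_eqI)
    fix y :: real
    assume y: "y \<in> {-1..1}"
    define a where "a = arccos y"
    have "cos a = y"
      using y by (simp add: a_def)
    moreover have "cos (real (t + 2) * a) + cos (real t * a) = 2 * cos a * cos (real (t + 1) * a)"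
      using cos_add[of "real (t + 1) * a" a] cos_diff[of "real (t + 1) * a" a]
      by (simp add: algebra_simps)
    ultimately show "poly (gegenbauer 0 (t + 2)) y = poly ([:0, 2:] * gegenbauer 0 (t + 1) - gegenbauer 0 t) y"
      using y by (simp add: C a_def)
  qed
  then show "poly (gegenbauer 0 (t + 2)) x = 2 * x * poly (gegenbauer 0 (t + 1)) x - poly (gegenbauer 0 t) x"
    by simp
qed

lemma zonal_0 [simp]: "zonal m 0 z w = 1"
  by (simp add: zonal_def)

lemma zonal_1 [simp]: "zonal m (Suc 0) z w = z"
  by (simp add: zonal_def zonal_coeff_eq_0)

text \<open>Both sides satisfy the same three-term recurrence with the same initial values. The
  constant is the Gegenbauer value at 1, since \<open>zonal\<close> is 1 at \<open>z = 1\<close>,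
  \<open>w = 0\<close>; the case \<open>\<nu> = 0\<close> is separate because
  \<open>pochhammer 0 t\<close> vanishes for \<open>t > 0\<close>.\<close>

lemma gegenbauer_eq_zonal:
  assumes "\<nu> \<ge> 0"
  shows "poly (gegenbauer \<nu> t) z
    = (if \<nu> = 0 then 1 else pochhammer (2 * \<nu>) t / fact t) * zonal (2 * \<nu> + 1) t z (1 - z\<^sup>2)"
proof (induction t rule: induct_nat_012)
  case 0
  then show ?case
    using gegenbauer_0_recurrence(1) gegenbauer_recurrence(1) by simp
next
  case 1
  then show ?case
    using gegenbauer_0_recurrence(2)[of z] gegenbauer_recurrence(2)[of \<nu> z] by simp
next
  case (ge2 t)
  let ?Z = "\<lambda>t. zonal (2 * \<nu> + 1) t z (1 - z\<^sup>2)"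
  have Z: "(real t + 1 + 2 * \<nu>) * ?Z (t + 2)
      = 2 * (real t + 1 + \<nu>) * z * ?Z (t + 1) - (real t + 1) * ?Z t"
    using zonal_recurrence[OF assms, of t z "1 - z\<^sup>2"] by simp
  show ?case
  proof (cases "\<nu> = 0")
    case True
    have "(real t + 1) * ?Z (t + 2) = (real t + 1) * (2 * z * ?Z (t + 1) - ?Z t)"
      using Z True by (simp add: algebra_simps)
    then have "?Z (t + 2) = 2 * z * ?Z (t + 1) - ?Z t"
      by (subst (asm) mult_left_cancel) auto
    then show ?thesis
      using ge2 True gegenbauer_0_recurrence(3)[of t z] by simp
  next
    case False
    define g where "g = pochhammer (2 * \<nu>) t / fact t"
    have g1: "pochhammer (2 * \<nu>) (Suc t) / fact (Suc t) = g * (2 * \<nu> + real t) / (real t + 1)"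
      by (simp add: g_def pochhammer_Suc field_simps)
    have g2: "pochhammer (2 * \<nu>) (Suc (Suc t)) / fact (Suc (Suc t))
        = g * (2 * \<nu> + real t) * (2 * \<nu> + real t + 1) / ((real t + 1) * (real t + 2))"
      by (simp add: g_def pochhammer_Suc field_simps)
    have "(real t + 2) * poly (gegenbauer \<nu> (t + 2)) z
        = 2 * (real t + 1 + \<nu>) * z * (g * (2 * \<nu> + real t) / (real t + 1) * ?Z (t + 1))
          - (real t + 2 * \<nu>) * (g * ?Z t)"
      unfolding gegenbauer_recurrence(3)[OF False] Suc_eq_plus1[symmetric] ge2 g1[symmetric]
      using False by (simp only: g_def if_False)
    also have "\<dots> = g * (2 * \<nu> + real t) / (real t + 1)
        * (2 * (real t + 1 + \<nu>) * z * ?Z (t + 1) - (real t + 1) * ?Z t)"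
      by (simp add: field_simps)
    also have "\<dots> = g * (2 * \<nu> + real t) / (real t + 1) * ((real t + 1 + 2 * \<nu>) * ?Z (t + 2))"
      by (simp only: Z)
    finally have p: "(real t + 2) * poly (gegenbauer \<nu> (t + 2)) z
        = g * (2 * \<nu> + real t) / (real t + 1) * ((real t + 1 + 2 * \<nu>) * ?Z (t + 2))" .
    have "poly (gegenbauer \<nu> (t + 2)) z
        = g * (2 * \<nu> + real t) / (real t + 1) * ((real t + 1 + 2 * \<nu>) * ?Z (t + 2)) / (real t + 2)"
      unfolding p[symmetric] by simp
    also have "\<dots> = g * (2 * \<nu> + real t) * (2 * \<nu> + real t + 1) / ((real t + 1) * (real t + 2)) * ?Z (t + 2)"
      by (simp add: mult_ac add_ac)
    finally show ?thesis
      unfolding g2 using False by simp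
  qed
qed

text \<open>Here \<open>2 * \<nu> + 1 = n - 1\<close> is the dimension of the space containing the
  smaller sphere. All scaling factors other than \<open>Q_at_one n t\<close> are visibly
  nonzero.\<close>

lemma Q_poly_root_iff:
  assumes "n \<ge> 2"
  shows "poly (Q_poly n t) z = 0 \<longleftrightarrow> Q_at_one n t = 0 \<or> zonal (real n - 1) t z (1 - z\<^sup>2) = 0"
proof -
  define \<nu> where "\<nu> = (real n - 2) / 2"
  have \<nu>: "\<nu> \<ge> 0" "2 * \<nu> + 1 = real n - 1"
    using assms by (auto simp: \<nu>_def field_simps)
  have "(if \<nu> = 0 then 1 else pochhammer (2 * \<nu>) t / fact t) \<noteq> 0"
    using \<nu>(1) pochhammer_pos[of "2 * \<nu>" t] by auto
  moreover have "poly (gegenbauer \<nu> t) 1 \<noteq> 0"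
    using gegenbauer_at_1_pos[OF \<nu>(1), of t] by simp
  ultimately show ?thesis
    using gegenbauer_eq_zonal[OF \<nu>(1), of t z] \<nu>(2)
    by (simp add: Q_poly_def Let_def \<nu>_def[symmetric])
qed

text \<open>If this value were 0, \<open>Q_poly\<close> would be zero and every \<open>r\<close> a
  root. For \<open>t \<ge> 2\<close>, Pascal's rule applied twice writes it as a sum of two binomial
  coefficients, one of them positive.\<close>

lemma Q_at_one_pos:
  assumes "n \<ge> 2"
  shows "Q_at_one n t > 0"
proof (cases "t < 2")
  case True
  then show ?thesis
    using assms by (auto simp: Q_at_one_def less_2_cases_iff)
next
  case False
  then obtain k where t: "t = k + 2"
    by (metis add.commute le_add_diff_inverse not_less)
  obtain l where n: "n = l + 2"
    using assms by (metis add.commute le_add_diff_inverse)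
  define N where "N = l + k + 1"
  have "Suc (Suc N) choose Suc (Suc k) = (N choose k) + (N choose Suc k) + (Suc N choose Suc (Suc k))"
    by simp
  moreover have "N choose Suc k > 0"
    by (simp add: zero_less_binomial_iff N_def)
  moreover have "n + t - 1 = Suc (Suc N)" "t = Suc (Suc k)" "n + t - 3 = N" "t - 2 = k"
    by (simp_all add: N_def n t)
  ultimately show ?thesis
    using False by (simp only: Q_at_one_def of_nat_add if_False)
qed

section \<open>Moments of the sphere\<close>

definition sphere_moment :: "('a::euclidean_space \<Rightarrow> nat) \<Rightarrow> real"
  where "sphere_moment \<alpha> = (LINT x|sphere_measure. monomial \<alpha> x)"

lemma monomial_update:
  fixes x :: "'a::euclidean_space"
  assumes "b \<in> Basis"
  shows "monomial (\<alpha>(b := k)) x = (x \<bullet> b) ^ k * (\<Prod>b'\<in>Basis - {b}. (x \<bullet> b') ^ \<alpha> b')"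
  using assms by (simp add: monomial_def prod.remove)

lemma borel_measurable_monomial [measurable]: "monomial \<alpha> \<in> borel_measurable borel"
  unfolding monomial_def by measurable

lemma measurable_sphere_measure_cong:
  "f \<in> borel \<rightarrow>\<^sub>M N \<Longrightarrow> f \<in> sphere_measure \<rightarrow>\<^sub>M N"
  unfolding measurable_cong_sets[OF sphere_measure_sets refl] by (rule measurable_restrict_space1)

lemma monomial_le_1:
  assumes "x \<in> sphere 0 1"
  shows "\<bar>monomial \<alpha> x\<bar> \<le> 1"
proof -
  have "\<bar>x \<bullet> b\<bar> \<le> 1" if "b \<in> Basis" for b
    using Basis_le_norm[OF that, of x] assms by simp
  then show ?thesis
    unfolding monomial_def abs_prod power_abs by (intro prod_le_1) (auto intro: power_le_one)
qed

lemma AE_sphere_measure: "(\<And>x. x \<in> sphere 0 1 \<Longrightarrow> P x) \<Longrightarrow> AE x in sphere_measure. P x"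
  using AE_space[of sphere_measure] by (rule eventually_mono) simp

lemma integrable_monomial [simp]: "integrable sphere_measure (monomial \<alpha>)"
  by (rule finite_measure.integrable_const_bound[where B = 1, OF finite_measure_sphere_measure])
     (auto intro!: AE_sphere_measure monomial_le_1 measurable_sphere_measure_cong)

text \<open>It is applied to a reflection and to plane rotations to obtain relations between
  moments.\<close>

lemma integral_sphere_orthogonal:
  fixes g :: "'a::euclidean_space \<Rightarrow> 'a" and u :: "'a \<Rightarrow> real"
  assumes g: "orthogonal_transformation g" and u: "u \<in> borel_measurable borel"
  shows "(LINT x|sphere_measure. u (g x)) = (LINT x|sphere_measure. u x)"
proof -
  have "linear g"
    using g by (rule orthogonal_transformation_linear)
  then have gm: "g \<in> borel_measurable borel"
    by (intro borel_measurable_continuous_onI linear_continuous_on) (simp add: linear_conv_bounded_linear)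
  have gs: "g \<in> sphere_measure \<rightarrow>\<^sub>M sphere_measure"
    unfolding measurable_cong_sets[OF sphere_measure_sets sphere_measure_sets]
    by (intro measurable_restrict_space3 gm) (auto simp: orthogonal_transformation_norm[OF g])
  show ?thesis
    using integral_distr[OF gs measurable_sphere_measure_cong[OF u]]
    by (simp add: distr_sphere_measure_orthogonal[OF g])
qed

text \<open>The reflection that negates the coordinate \<open>b\<close> changes the sign of the
  monomial but not its integral.\<close>

lemma sphere_moment_odd:
  fixes \<alpha> :: "'a::euclidean_space \<Rightarrow> nat"
  assumes b: "b \<in> Basis" and "odd (\<alpha> b)"
  shows "sphere_moment \<alpha> = 0"
proof -
  define g where "g x = x - (2 * (x \<bullet> b)) *\<^sub>R b" for x :: 'a
  have g: "orthogonal_transformation g"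
    unfolding orthogonal_transformation_def
  proof (intro conjI allI)
    show "linear g"
      by (rule linearI) (simp_all add: g_def algebra_simps)
    show "g v \<bullet> g w = v \<bullet> w" for v w
      using b by (simp add: g_def algebra_simps inner_commute)
  qed
  have "monomial \<alpha> (g x) = - monomial \<alpha> x" for x
  proof -
    have "g x \<bullet> b = - (x \<bullet> b)"
      using b by (simp add: g_def algebra_simps)
    moreover have "g x \<bullet> b' = x \<bullet> b'" if "b' \<in> Basis - {b}" for b'
      using b that by (auto simp: g_def inner_diff_left inner_not_same_Basis)
    ultimately show ?thesis
      using monomial_update[OF b, of \<alpha> "\<alpha> b"] assms(2) by simp
  qed
  then show ?thesis
    using integral_sphere_orthogonal[OF g borel_measurable_monomial, of \<alpha>]
    by (simp add: sphere_moment_def)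
qed

text \<open>Written as \<open>x\<close> plus a correction in the span of \<open>i\<close> and
  \<open>j\<close>, so that the other coordinates are visibly fixed.\<close>

definition plane_rotation :: "'a \<Rightarrow> 'a \<Rightarrow> real \<Rightarrow> 'a \<Rightarrow> 'a::euclidean_space"
  where "plane_rotation i j \<theta> x = x + ((cos \<theta> - 1) * (x \<bullet> i) - sin \<theta> * (x \<bullet> j)) *\<^sub>R i
    + (sin \<theta> * (x \<bullet> i) + (cos \<theta> - 1) * (x \<bullet> j)) *\<^sub>R j"

lemma plane_rotation_inner:
  assumes "i \<in> Basis" "j \<in> Basis" "i \<noteq> j"
  shows "plane_rotation i j \<theta> x \<bullet> i = cos \<theta> * (x \<bullet> i) - sin \<theta> * (x \<bullet> j)"
    and "plane_rotation i j \<theta> x \<bullet> j = sin \<theta> * (x \<bullet> i) + cos \<theta> * (x \<bullet> j)"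
    and "b \<in> Basis - {i, j} \<Longrightarrow> plane_rotation i j \<theta> x \<bullet> b = x \<bullet> b"
  using assms by (auto simp: plane_rotation_def inner_Basis algebra_simps)

lemma orthogonal_transformation_plane_rotation:
  fixes i j :: "'a::euclidean_space"
  assumes "i \<in> Basis" "j \<in> Basis" "i \<noteq> j"
  shows "orthogonal_transformation (plane_rotation i j \<theta>)"
  unfolding orthogonal_transformation_def
proof (intro conjI allI)
  show "linear (plane_rotation i j \<theta>)"
    by (rule linearI) (simp_all add: plane_rotation_def algebra_simps)
  fix v w :: 'a
  have split: "x \<bullet> y = (x \<bullet> i) * (y \<bullet> i) + (x \<bullet> j) * (y \<bullet> j) + (\<Sum>b\<in>Basis - {i, j}. (x \<bullet> b) * (y \<bullet> b))"
    for x y :: 'a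
  proof -
    have "Basis - {i, j} = Basis - {i} - {j}"
      by auto
    then show ?thesis
      unfolding euclidean_inner[of x y] using assms by (simp add: sum.remove[of _ i] sum.remove[of _ j])
  qed
  have rest: "(\<Sum>b\<in>Basis - {i, j}. (plane_rotation i j \<theta> v \<bullet> b) * (plane_rotation i j \<theta> w \<bullet> b))
      = (\<Sum>b\<in>Basis - {i, j}. (v \<bullet> b) * (w \<bullet> b))"
    by (intro sum.cong refl) (simp add: plane_rotation_inner[OF assms])
  have "(c * a - s * b) * (c * a' - s * b') + (s * a + c * b) * (s * a' + c * b')
      = (s\<^sup>2 + c\<^sup>2) * (a * a' + b * b')" for a b a' b' c s :: real
    by (simp add: algebra_simps power2_eq_square)
  then show "plane_rotation i j \<theta> v \<bullet> plane_rotation i j \<theta> w = v \<bullet> w"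
    unfolding split[of "plane_rotation i j \<theta> v" "plane_rotation i j \<theta> w"] rest plane_rotation_inner(1,2)[OF assms]
    by (simp add: split[of v w])
qed

text \<open>
  Since the integral of a function over the sphere does not change under the rotation by \<open>\<theta>\<close>
  in the plane of \<open>i\<close> and \<open>j\<close>, the integral of its derivative at \<open>\<theta> = 0\<close> vanishes; here the
  function is the monomial with exponents \<open>\<gamma> + i + j\<close>.
\<close>

lemma sphere_moment_exchange:
  fixes \<gamma> :: "'a::euclidean_space \<Rightarrow> nat"
  assumes ij: "i \<in> Basis" "j \<in> Basis" "i \<noteq> j"
  shows "real (\<gamma> j + 1) * sphere_moment (\<gamma>(i := \<gamma> i + 2)) = real (\<gamma> i + 1) * sphere_moment (\<gamma>(j := \<gamma> j + 2))"
proof -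
  define a c where "a = \<gamma> i" "c = \<gamma> j"
  define G where "G x = (\<Prod>b\<in>Basis - {i, j}. (x \<bullet> b) ^ \<gamma> b)" for x :: 'a
  define u where "u = monomial (\<gamma>(i := a + 1, j := c + 1))"
  define D where "D x = real (c + 1) * monomial (\<gamma>(i := a + 2)) x - real (a + 1) * monomial (\<gamma>(j := c + 2)) x" for x :: 'a
  have mono: "monomial \<delta> x = (x \<bullet> i) ^ \<delta> i * (x \<bullet> j) ^ \<delta> j * G x" if "\<And>b. b \<notin> {i, j} \<Longrightarrow> \<delta> b = \<gamma> b" for \<delta> x
  proof -
    have "Basis - {i, j} = Basis - {i} - {j}"
      by auto
    moreover have "G x = (\<Prod>b\<in>Basis - {i, j}. (x \<bullet> b) ^ \<delta> b)"
      unfolding G_def by (intro prod.cong) (simp_all add: that)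
    ultimately show ?thesis
      unfolding monomial_def using ij by (simp add: prod.remove[of _ i] prod.remove[of _ j])
  qed
  have u: "u x = (x \<bullet> i) ^ (a + 1) * (x \<bullet> j) ^ (c + 1) * G x" for x
    unfolding u_def by (subst mono) (use ij in auto)
  have D: "D x = (real (c + 1) * (x \<bullet> i) ^ (a + 2) * (x \<bullet> j) ^ c - real (a + 1) * (x \<bullet> i) ^ a * (x \<bullet> j) ^ (c + 2)) * G x" for x
    unfolding D_def by (subst (1 2) mono) (use ij in \<open>auto simp: a_c_def algebra_simps\<close>)
  define R where "R = plane_rotation i j"
  have R: "R \<theta> x \<bullet> i = cos \<theta> * (x \<bullet> i) - sin \<theta> * (x \<bullet> j)" "R \<theta> x \<bullet> j = sin \<theta> * (x \<bullet> i) + cos \<theta> * (x \<bullet> j)"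
    "G (R \<theta> x) = G x" for \<theta> x
    using plane_rotation_inner[OF ij] by (auto simp: R_def G_def intro!: prod.cong)
  \<comment> \<open>Rotating turns the coordinates \<open>i\<close>, \<open>j\<close> with velocity
    \<open>(- x \<bullet> j, x \<bullet> i)\<close>; applying this to \<open>u\<close> gives
    \<open>D\<close>, evaluated at the rotated point.\<close>
  have deriv: "((\<lambda>\<theta>. u (R \<theta> x)) has_real_derivative D (R \<theta> x)) (at \<theta>)" for \<theta> x
    unfolding u D R
    by (rule derivative_eq_intros refl | simp)+ (simp add: algebra_simps power2_eq_square)
  have R0: "R 0 x = x" for x
    by (simp add: R_def plane_rotation_def)
  have R_sphere: "R \<theta> x \<in> sphere 0 1" if "x \<in> sphere 0 1" for \<theta> x
    using orthogonal_transformation_norm[OF orthogonal_transformation_plane_rotation[OF ij], of \<theta> x] that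
    by (simp add: R_def)
  have D_bound: "\<bar>D x\<bar> \<le> real (a + c + 2)" if "x \<in> sphere 0 1" for x
  proof -
    have "\<bar>D x\<bar> \<le> \<bar>real (c + 1) * monomial (\<gamma>(i := a + 2)) x\<bar> + \<bar>real (a + 1) * monomial (\<gamma>(j := c + 2)) x\<bar>"
      unfolding D_def by (rule abs_triangle_ineq4)
    also have "\<dots> \<le> real (c + 1) * 1 + real (a + 1) * 1"
      unfolding abs_mult using monomial_le_1[OF that] by (intro add_mono mult_mono) auto
    finally show ?thesis by simp
  qed
  \<comment> \<open>By the mean value theorem the bound on \<open>D\<close> also bounds the
    difference quotients, which supplies the dominating constant.\<close>
  have lipschitz: "\<bar>u (R h x) - u x\<bar> \<le> real (a + c + 2) * h" if "x \<in> sphere 0 1" "h > 0" for x h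
  proof -
    obtain z where "u (R h x) - u (R 0 x) = (h - 0) * D (R z x)"
      using MVT2[OF \<open>h > 0\<close>, of "\<lambda>\<theta>. u (R \<theta> x)" "\<lambda>\<theta>. D (R \<theta> x)"] deriv by blast
    then show ?thesis
      using D_bound[OF R_sphere[OF that(1)], of z] that(2) by (simp add: R0 abs_mult mult.commute)
  qed
  define h where "h n = 1 / real (Suc n)" for n
  have h: "h n > 0" for n
    by (simp add: h_def)
  have [measurable]: "u \<in> borel_measurable borel" "D \<in> borel_measurable borel"
    unfolding u_def D_def[abs_def] by measurable
  have int_u: "(LINT x|sphere_measure. u (R \<theta> x)) = (LINT x|sphere_measure. u x)" for \<theta>
    unfolding R_def by (intro integral_sphere_orthogonal orthogonal_transformation_plane_rotation ij) measurable
  have R_meas [measurable]: "R \<theta> \<in> borel_measurable borel" for \<theta>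
    unfolding R_def plane_rotation_def[abs_def] by measurable
  have meas_quot: "(\<lambda>x. (u (R \<theta> x) - u x) / \<theta>) \<in> borel_measurable borel" for \<theta>
    by measurable
  have u_int: "integrable sphere_measure u"
    by (simp add: u_def)
  have uR_int: "integrable sphere_measure (\<lambda>x. u (R \<theta> x))" for \<theta>
    by (rule finite_measure.integrable_const_bound[where B = 1, OF finite_measure_sphere_measure])
       (auto intro!: AE_sphere_measure monomial_le_1 measurable_sphere_measure_cong simp: u_def R_sphere[simplified])
  \<comment> \<open>Each integral on the left is 0 by invariance, so the limit is 0 as well.\<close>
  have "(\<lambda>n. LINT x|sphere_measure. (u (R (h n) x) - u x) / h n) \<longlonglongrightarrow> (LINT x|sphere_measure. D x)"
  proof (rule integral_dominated_convergence[where w = "\<lambda>_. real (a + c + 2)"])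
    show "AE x in sphere_measure. (\<lambda>n. (u (R (h n) x) - u x) / h n) \<longlonglongrightarrow> D x"
    proof (rule AE_sphere_measure)
      fix x
      have lim: "((\<lambda>\<theta>. (u (R (0 + \<theta>) x) - u (R 0 x)) / \<theta>) \<longlongrightarrow> D (R 0 x)) (at 0)"
        using deriv[of x 0] by (simp add: DERIV_def)
      have "filterlim h (at 0) sequentially"
      proof (rule filterlim_atI)
        show "h \<longlonglongrightarrow> 0"
          using LIMSEQ_inverse_real_of_nat by (simp add: h_def[abs_def] inverse_eq_divide)
      qed (simp add: h_def)
      from filterlim_compose[OF lim this]
      show "(\<lambda>n. (u (R (h n) x) - u x) / h n) \<longlonglongrightarrow> D x"
        by (simp only: R0 add_0)
    qed
    show "AE x in sphere_measure. norm ((u (R (h n) x) - u x) / h n) \<le> real (a + c + 2)" for n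
      using lipschitz[OF _ h] h[of n]
      by (intro AE_sphere_measure) (auto simp: divide_le_eq)
  qed (auto intro!: measurable_sphere_measure_cong meas_quot
      finite_measure.integrable_const[OF finite_measure_sphere_measure])
  moreover have "(LINT x|sphere_measure. (u (R (h n) x) - u x) / h n) = 0" for n
    using u_int uR_int int_u by simp
  ultimately have "(LINT x|sphere_measure. D x) = 0"
    by (simp only: LIMSEQ_const_iff)
  then show ?thesis
    by (simp add: D_def sphere_moment_def a_c_def)
qed

text \<open>On the sphere the squares of the coordinates sum to 1, so the moments with one exponent
  raised by 2 sum to \<open>sphere_moment \<gamma>\<close>. The exchange lemma expresses each of
  them through the one for \<open>i\<close>.\<close>

lemma sphere_moment_add_2:
  fixes \<gamma> :: "'a::euclidean_space \<Rightarrow> nat"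
  assumes i: "i \<in> Basis"
  shows "(real (\<Sum>b\<in>Basis. \<gamma> b) + real DIM('a)) * sphere_moment (\<gamma>(i := \<gamma> i + 2)) = real (\<gamma> i + 1) * sphere_moment \<gamma>"
proof -
  have "(\<Sum>j\<in>Basis. monomial (\<gamma>(j := \<gamma> j + 2)) x) = monomial \<gamma> x" if "x \<in> sphere 0 1" for x
  proof -
    have "monomial (\<gamma>(j := \<gamma> j + 2)) x = (x \<bullet> j)\<^sup>2 * monomial \<gamma> x" if "j \<in> Basis" for j
    proof -
      have "monomial \<gamma> x = (x \<bullet> j) ^ \<gamma> j * (\<Prod>b\<in>Basis - {j}. (x \<bullet> b) ^ \<gamma> b)"
        using monomial_update[OF that, of \<gamma> "\<gamma> j" x] by simp
      then show ?thesis
        unfolding monomial_update[OF that] by (simp only: power_add mult.assoc mult.left_commute)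
    qed
    then have "(\<Sum>j\<in>Basis. monomial (\<gamma>(j := \<gamma> j + 2)) x) = (\<Sum>j\<in>Basis. (x \<bullet> j)\<^sup>2) * monomial \<gamma> x"
      by (simp add: sum_distrib_right)
    also have "(\<Sum>j\<in>Basis. (x \<bullet> j)\<^sup>2) = 1"
      using that euclidean_inner[of x x] by (simp add: power2_eq_square norm_eq_1)
    finally show ?thesis by (simp only: mult_1_left)
  qed
  then have "(LINT x|sphere_measure. (\<Sum>j\<in>Basis. monomial (\<gamma>(j := \<gamma> j + 2)) x)) = sphere_moment \<gamma>"
    unfolding sphere_moment_def by (intro Bochner_Integration.integral_cong) auto
  then have sum: "(\<Sum>j\<in>Basis. sphere_moment (\<gamma>(j := \<gamma> j + 2))) = sphere_moment \<gamma>"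
    by (simp add: sphere_moment_def)
  have "(real (\<Sum>b\<in>Basis. \<gamma> b) + real DIM('a)) * sphere_moment (\<gamma>(i := \<gamma> i + 2))
      = (\<Sum>j\<in>Basis. real (\<gamma> j + 1) * sphere_moment (\<gamma>(i := \<gamma> i + 2)))"
    by (simp add: sum_distrib_right[symmetric] sum.distrib)
  also have "\<dots> = (\<Sum>j\<in>Basis. real (\<gamma> i + 1) * sphere_moment (\<gamma>(j := \<gamma> j + 2)))"
  proof (intro sum.cong refl)
    fix j :: 'a
    assume "j \<in> Basis"
    then show "real (\<gamma> j + 1) * sphere_moment (\<gamma>(i := \<gamma> i + 2)) = real (\<gamma> i + 1) * sphere_moment (\<gamma>(j := \<gamma> j + 2))"
      using sphere_moment_exchange[OF i, of j \<gamma>] by (cases "i = j") simp_all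
  qed
  also have "\<dots> = real (\<gamma> i + 1) * sphere_moment \<gamma>"
    by (simp only: sum_distrib_left[symmetric] sum)
  finally show ?thesis .
qed

text \<open>Termwise this is \<open>sphere_moment_add_2\<close> with the exponent at
  \<open>b\<close> lowered by 2. If \<open>\<alpha> b\<close> is 0 both sides vanish; if it is 1,
  the left factor is 0 and the right moment is odd.\<close>

lemma sphere_moment_laplacian:
  fixes \<alpha> :: "'a::euclidean_space \<Rightarrow> nat"
  defines "k \<equiv> real (\<Sum>b\<in>Basis. \<alpha> b)"
  shows "(\<Sum>b\<in>Basis. real (\<alpha> b) * (real (\<alpha> b) - 1) * sphere_moment (\<alpha>(b := \<alpha> b - 2)))
    = k * (k + real DIM('a) - 2) * sphere_moment \<alpha>"
proof -
  have "real (\<alpha> b) * (real (\<alpha> b) - 1) * sphere_moment (\<alpha>(b := \<alpha> b - 2))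
      = real (\<alpha> b) * ((k + real DIM('a) - 2) * sphere_moment \<alpha>)" if b: "b \<in> Basis" for b
  proof -
    consider "\<alpha> b = 0" | "\<alpha> b = 1" | n where "\<alpha> b = n + 2"
      by (metis One_nat_def add_2_eq_Suc' not0_implies_Suc)
    then show ?thesis
    proof cases
      case 2
      then show ?thesis
        using sphere_moment_odd[OF b, of \<alpha>] by simp
    next
      case 3
      define \<gamma> where "\<gamma> = \<alpha>(b := n)"
      have "\<gamma>(b := \<gamma> b + 2) = \<alpha>" "\<alpha>(b := \<alpha> b - 2) = \<gamma>"
        using 3 by (auto simp: \<gamma>_def)
      moreover have "(\<Sum>b\<in>Basis. \<alpha> b) = (\<Sum>b\<in>Basis. \<gamma> b) + 2"
        using b 3 by (simp add: sum.remove[of _ b] \<gamma>_def)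
      ultimately show ?thesis
        using sphere_moment_add_2[OF b, of \<gamma>] 3 by (simp add: k_def \<gamma>_def algebra_simps)
    qed simp
  qed
  then have "(\<Sum>b\<in>Basis. real (\<alpha> b) * (real (\<alpha> b) - 1) * sphere_moment (\<alpha>(b := \<alpha> b - 2)))
      = (\<Sum>b\<in>Basis. real (\<alpha> b) * ((k + real DIM('a) - 2) * sphere_moment \<alpha>))"
    by (rule sum.cong[OF refl])
  also have "\<dots> = k * (k + real DIM('a) - 2) * sphere_moment \<alpha>"
    by (simp add: k_def sum_distrib_right mult.assoc)
  finally show ?thesis .
qed

section \<open>Harmonic polynomials and designs\<close>

text \<open>The truncated exponent \<open>\<alpha> b - 2\<close> is harmless, since its factor is 0
  for \<open>\<alpha> b < 2\<close>.\<close>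

lemma laplacian_sum_monomial:
  fixes x :: "'a::euclidean_space"
  shows "laplacian (\<lambda>x. \<Sum>\<alpha>\<in>A. c \<alpha> * monomial \<alpha> x) x
    = (\<Sum>\<alpha>\<in>A. c \<alpha> * (\<Sum>b\<in>Basis. real (\<alpha> b) * (real (\<alpha> b) - 1) * monomial (\<alpha>(b := \<alpha> b - 2)) x))"
proof -
  have "(deriv ^^ 2) (\<lambda>s. \<Sum>\<alpha>\<in>A. c \<alpha> * monomial \<alpha> (x + s *\<^sub>R b)) 0
      = (\<Sum>\<alpha>\<in>A. c \<alpha> * (real (\<alpha> b) * (real (\<alpha> b) - 1) * monomial (\<alpha>(b := \<alpha> b - 2)) x))"
    if b: "b \<in> Basis" for b
  proof -
    define R where "R \<alpha> = (\<Prod>b'\<in>Basis - {b}. (x \<bullet> b') ^ \<alpha> b')" for \<alpha>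
    have "monomial \<alpha> (x + s *\<^sub>R b) = (x \<bullet> b + s) ^ \<alpha> b * R \<alpha>" for \<alpha> s
    proof -
      have "(x + s *\<^sub>R b) \<bullet> b = x \<bullet> b + s"
        using b by (simp add: inner_add_left)
      moreover have "(x + s *\<^sub>R b) \<bullet> b' = x \<bullet> b'" if "b' \<in> Basis - {b}" for b'
        using b that by (auto simp: inner_add_left inner_not_same_Basis)
      ultimately show ?thesis
        using monomial_update[OF b, of \<alpha> "\<alpha> b" "x + s *\<^sub>R b"] by (simp add: R_def)
    qed
    then have "(\<lambda>s. \<Sum>\<alpha>\<in>A. c \<alpha> * monomial \<alpha> (x + s *\<^sub>R b)) = (\<lambda>s. \<Sum>\<alpha>\<in>A. c \<alpha> * ((x \<bullet> b + s) ^ \<alpha> b * R \<alpha>))"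
      by simp
    moreover have "deriv (\<lambda>s. \<Sum>\<alpha>\<in>A. c \<alpha> * ((x \<bullet> b + s) ^ \<alpha> b * R \<alpha>))
        = (\<lambda>s. \<Sum>\<alpha>\<in>A. c \<alpha> * (real (\<alpha> b) * (x \<bullet> b + s) ^ (\<alpha> b - 1) * R \<alpha>))"
      by (rule ext, rule DERIV_imp_deriv) (auto intro!: derivative_eq_intros sum.cong)
    moreover have "deriv (\<lambda>s. \<Sum>\<alpha>\<in>A. c \<alpha> * (real (\<alpha> b) * (x \<bullet> b + s) ^ (\<alpha> b - 1) * R \<alpha>)) 0
        = (\<Sum>\<alpha>\<in>A. c \<alpha> * (real (\<alpha> b) * (real (\<alpha> b - 1) * (x \<bullet> b + 0) ^ (\<alpha> b - 1 - 1)) * R \<alpha>))"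
      by (rule DERIV_imp_deriv) (auto intro!: derivative_eq_intros sum.cong)
    ultimately have "(deriv ^^ 2) (\<lambda>s. \<Sum>\<alpha>\<in>A. c \<alpha> * monomial \<alpha> (x + s *\<^sub>R b)) 0
        = (\<Sum>\<alpha>\<in>A. c \<alpha> * (real (\<alpha> b) * (real (\<alpha> b - 1) * (x \<bullet> b + 0) ^ (\<alpha> b - 1 - 1)) * R \<alpha>))"
      by (simp add: numeral_2_eq_2)
    also have "\<dots> = (\<Sum>\<alpha>\<in>A. c \<alpha> * (real (\<alpha> b) * (real (\<alpha> b) - 1) * monomial (\<alpha>(b := \<alpha> b - 2)) x))"
    proof (intro sum.cong refl)
      fix \<alpha>
      show "c \<alpha> * (real (\<alpha> b) * (real (\<alpha> b - 1) * (x \<bullet> b + 0) ^ (\<alpha> b - 1 - 1)) * R \<alpha>)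
          = c \<alpha> * (real (\<alpha> b) * (real (\<alpha> b) - 1) * monomial (\<alpha>(b := \<alpha> b - 2)) x)"
        by (cases "\<alpha> b") (simp_all add: monomial_update[OF b] R_def)
    qed
    finally show ?thesis .
  qed
  then have "laplacian (\<lambda>x. \<Sum>\<alpha>\<in>A. c \<alpha> * monomial \<alpha> x) x
      = (\<Sum>b\<in>Basis. \<Sum>\<alpha>\<in>A. c \<alpha> * (real (\<alpha> b) * (real (\<alpha> b) - 1) * monomial (\<alpha>(b := \<alpha> b - 2)) x))"
    unfolding laplacian_def by (rule sum.cong[OF refl])
  also have "\<dots> = (\<Sum>\<alpha>\<in>A. c \<alpha> * (\<Sum>b\<in>Basis. real (\<alpha> b) * (real (\<alpha> b) - 1) * monomial (\<alpha>(b := \<alpha> b - 2)) x))"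
    unfolding sum_distrib_left by (rule sum.swap)
  finally show ?thesis .
qed

section \<open>Splitting off the first coordinate\<close>

lemma Basis_real_prod: "(Basis :: (real \<times> 'a::euclidean_space) set) = insert (1, 0) (Pair 0 ` Basis)"
  by (auto simp: Basis_prod_def)

lemma sum_Basis_real_prod:
  "sum f (Basis :: (real \<times> 'a::euclidean_space) set) = f (1, 0) + (\<Sum>b\<in>Basis. f (0, b))"
  unfolding Basis_real_prod by (subst sum.insert) (auto simp: sum.reindex inj_on_def)

lemma monomial_real_prod:
  fixes \<alpha> :: "real \<times> 'a::euclidean_space \<Rightarrow> nat"
  shows "monomial \<alpha> (z, x) = z ^ \<alpha> (1, 0) * monomial (\<lambda>b. \<alpha> (0, b)) x"
  unfolding monomial_def Basis_real_prod by (subst prod.insert) (auto simp: prod.reindex inj_on_def)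

text \<open>The sum is the integral of \<open>f (z, s *\<^sub>R x)\<close> over the unit sphere in
  \<open>x\<close>. The witness \<open>C\<close> is \<open>a 0\<close>; the recurrence fixes all
  other averages.\<close>

lemma harmonic_sphere_integral:
  fixes A :: "(real \<times> 'a::euclidean_space \<Rightarrow> nat) set" and c :: "(real \<times> 'a \<Rightarrow> nat) \<Rightarrow> real"
  assumes A: "finite A" and deg: "\<And>\<alpha>. \<alpha> \<in> A \<Longrightarrow> (\<Sum>b\<in>Basis. \<alpha> b) = t"
    and harm: "\<And>x. laplacian (\<lambda>x. \<Sum>\<alpha>\<in>A. c \<alpha> * monomial \<alpha> x) x = 0"
  shows "\<exists>C. \<forall>z s. (\<Sum>\<alpha>\<in>A. c \<alpha> * (z ^ \<alpha> (1, 0) * s ^ (\<Sum>b\<in>Basis. \<alpha> (0, b)) * sphere_moment (\<lambda>b. \<alpha> (0, b))))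
    = C * zonal (real DIM('a)) t z (s\<^sup>2)"
proof -
  define m where "m = real DIM('a)"
  have m: "m > 0"
    by (simp add: m_def)
  define d where "d \<alpha> = (\<Sum>b\<in>Basis. \<alpha> (0, b))" for \<alpha> :: "real \<times> 'a \<Rightarrow> nat"
  define M where "M \<alpha> = sphere_moment (\<lambda>b. \<alpha> (0, b))" for \<alpha> :: "real \<times> 'a \<Rightarrow> nat"
  define a where "a k = (\<Sum>\<alpha>\<in>A. if d \<alpha> = k then c \<alpha> * M \<alpha> else 0)" for k
  have d: "\<alpha> (1, 0) + d \<alpha> = t" if "\<alpha> \<in> A" for \<alpha>
    using deg[OF that] by (simp add: sum_Basis_real_prod d_def)
  have a_big: "a k = 0" if "k > t" for k
    unfolding a_def using d that by (intro sum.neutral) fastforce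
  have a_odd: "a k = 0" if "odd k" for k
  proof -
    have "M \<alpha> = 0" if "odd (d \<alpha>)" for \<alpha>
    proof -
      obtain b where "b \<in> Basis" "odd (\<alpha> (0, b))"
        using \<open>odd (d \<alpha>)\<close> unfolding d_def by (meson dvd_sum)
      then show ?thesis
        unfolding M_def by (rule sphere_moment_odd)
    qed
    then show ?thesis
      unfolding a_def using that by (intro sum.neutral) auto
  qed
  \<comment> \<open>The equation \<open>laplacian f (z, x) = 0\<close> is integrated over
    \<open>x\<close> in the unit sphere, with \<open>z\<close> left free.\<close>
  have radial: "(\<Sum>\<alpha>\<in>A. c \<alpha> * (real (\<alpha> (1, 0)) * (real (\<alpha> (1, 0)) - 1) * z ^ (\<alpha> (1, 0) - 2) * M \<alpha>
      + z ^ \<alpha> (1, 0) * (real (d \<alpha>) * (real (d \<alpha>) + m - 2) * M \<alpha>))) = 0" for z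
  proof -
    have "(\<Sum>\<alpha>\<in>A. c \<alpha> * (real (\<alpha> (1, 0)) * (real (\<alpha> (1, 0)) - 1) * (z ^ (\<alpha> (1, 0) - 2) * monomial (\<lambda>b. \<alpha> (0, b)) x)
        + (\<Sum>b\<in>Basis. real (\<alpha> (0, b)) * (real (\<alpha> (0, b)) - 1) * (z ^ \<alpha> (1, 0)
            * monomial ((\<lambda>b. \<alpha> (0, b))(b := \<alpha> (0, b) - 2)) x)))) = 0" for x
    proof -
      have "(\<lambda>b'. (\<alpha>((0, b) := n)) (0, b')) = (\<lambda>b. \<alpha> (0, b))(b := n)" for \<alpha> :: "real \<times> 'a \<Rightarrow> nat" and b n
        by auto
      then show ?thesis
        using harm[of "(z, x)"]
        unfolding laplacian_sum_monomial sum_Basis_real_prod monomial_real_prod by simp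
    qed
    then have "0 = (LINT x|sphere_measure. (\<Sum>\<alpha>\<in>A. c \<alpha> * (real (\<alpha> (1, 0)) * (real (\<alpha> (1, 0)) - 1) * (z ^ (\<alpha> (1, 0) - 2) * monomial (\<lambda>b. \<alpha> (0, b)) x)
        + (\<Sum>b\<in>Basis. real (\<alpha> (0, b)) * (real (\<alpha> (0, b)) - 1) * (z ^ \<alpha> (1, 0)
            * monomial ((\<lambda>b. \<alpha> (0, b))(b := \<alpha> (0, b) - 2)) x)))))"
      by simp
    also have "\<dots> = (\<Sum>\<alpha>\<in>A. c \<alpha> * (real (\<alpha> (1, 0)) * (real (\<alpha> (1, 0)) - 1) * (z ^ (\<alpha> (1, 0) - 2) * M \<alpha>)
        + (\<Sum>b\<in>Basis. real (\<alpha> (0, b)) * (real (\<alpha> (0, b)) - 1) * (z ^ \<alpha> (1, 0)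
            * sphere_moment ((\<lambda>b. \<alpha> (0, b))(b := \<alpha> (0, b) - 2))))))"
      by (simp add: sphere_moment_def M_def)
    also have "\<dots> = (\<Sum>\<alpha>\<in>A. c \<alpha> * (real (\<alpha> (1, 0)) * (real (\<alpha> (1, 0)) - 1) * z ^ (\<alpha> (1, 0) - 2) * M \<alpha>
      + z ^ \<alpha> (1, 0) * (real (d \<alpha>) * (real (d \<alpha>) + m - 2) * M \<alpha>)))"
    proof (intro sum.cong refl)
      fix \<alpha> :: "real \<times> 'a \<Rightarrow> nat"
      have "(\<Sum>b\<in>Basis. real (\<alpha> (0, b)) * (real (\<alpha> (0, b)) - 1) * (z ^ \<alpha> (1, 0)
            * sphere_moment ((\<lambda>b. \<alpha> (0, b))(b := \<alpha> (0, b) - 2))))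
          = z ^ \<alpha> (1, 0) * (real (d \<alpha>) * (real (d \<alpha>) + m - 2) * M \<alpha>)"
        unfolding d_def m_def M_def sphere_moment_laplacian[symmetric] sum_distrib_left
        by (intro sum.cong refl) (simp only: mult_ac)
      then show "c \<alpha> * (real (\<alpha> (1, 0)) * (real (\<alpha> (1, 0)) - 1) * (z ^ (\<alpha> (1, 0) - 2) * M \<alpha>)
        + (\<Sum>b\<in>Basis. real (\<alpha> (0, b)) * (real (\<alpha> (0, b)) - 1) * (z ^ \<alpha> (1, 0)
            * sphere_moment ((\<lambda>b. \<alpha> (0, b))(b := \<alpha> (0, b) - 2)))))
        = c \<alpha> * (real (\<alpha> (1, 0)) * (real (\<alpha> (1, 0)) - 1) * z ^ (\<alpha> (1, 0) - 2) * M \<alpha>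
      + z ^ \<alpha> (1, 0) * (real (d \<alpha>) * (real (d \<alpha>) + m - 2) * M \<alpha>))"
        by (simp only: mult.assoc)
    qed
    finally show ?thesis
      by (rule sym)
  qed
  have a_rec: "(real k + 2) * (real k + m) * a (k + 2) = - ((real t - real k) * (real t - real k - 1)) * a k"
    if k: "k + 2 \<le> t" for k
  proof -
    \<comment> \<open>This is \<open>radial\<close> as a polynomial in \<open>z\<close>. Its
      coefficient at \<open>t - (k + 2)\<close> collects the second \<open>z\<close>-derivative of
      terms with \<open>d \<alpha> = k\<close> and the \<open>x\<close>-Laplacian of those with
      \<open>d \<alpha> = k + 2\<close>.\<close>
    define p where "p = (\<Sum>\<alpha>\<in>A. monom (c \<alpha> * (real (\<alpha> (1, 0)) * (real (\<alpha> (1, 0)) - 1) * M \<alpha>)) (\<alpha> (1, 0) - 2)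
      + monom (c \<alpha> * (real (d \<alpha>) * (real (d \<alpha>) + m - 2) * M \<alpha>)) (\<alpha> (1, 0)))"
    have "poly p z = 0" for z
      using radial[of z] by (simp add: p_def poly_sum poly_monom algebra_simps)
    then have "p = 0"
      using poly_all_0_iff_0 by blast
    then have "0 = coeff p (t - (k + 2))"
      by simp
    also have "\<dots> = (\<Sum>\<alpha>\<in>A. (real t - real k) * (real t - real k - 1) * (if d \<alpha> = k then c \<alpha> * M \<alpha> else 0)
        + (real k + 2) * (real k + m) * (if d \<alpha> = k + 2 then c \<alpha> * M \<alpha> else 0))"
      unfolding p_def coeff_sum
    proof (intro sum.cong refl)
      fix \<alpha>
      assume "\<alpha> \<in> A"
      note d\<alpha> = d[OF this]
      have "coeff (monom (c \<alpha> * (real (\<alpha> (1, 0)) * (real (\<alpha> (1, 0)) - 1) * M \<alpha>)) (\<alpha> (1, 0) - 2)) (t - (k + 2))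
          = (real t - real k) * (real t - real k - 1) * (if d \<alpha> = k then c \<alpha> * M \<alpha> else 0)"
      proof (cases "d \<alpha> = k")
        case True
        then have "\<alpha> (1, 0) - 2 = t - (k + 2)" "real (\<alpha> (1, 0)) = real t - real k"
          using d\<alpha> by linarith+
        then show ?thesis
          using True by simp
      next
        case False
        \<comment> \<open>Truncation can make the exponents coincide, but only where the second
          derivative in \<open>z\<close> is zero.\<close>
        then have "\<alpha> (1, 0) - 2 \<noteq> t - (k + 2) \<or> \<alpha> (1, 0) = 0 \<or> \<alpha> (1, 0) = 1"
          using d\<alpha> k by linarith
        then show ?thesis
          using False by auto
      qed
      moreover have "coeff (monom (c \<alpha> * (real (d \<alpha>) * (real (d \<alpha>) + m - 2) * M \<alpha>)) (\<alpha> (1, 0))) (t - (k + 2))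
          = (real k + 2) * (real k + m) * (if d \<alpha> = k + 2 then c \<alpha> * M \<alpha> else 0)"
      proof (cases "d \<alpha> = k + 2")
        case True
        then have "\<alpha> (1, 0) = t - (k + 2)"
          using d\<alpha> by linarith
        then show ?thesis
          using True by (simp add: algebra_simps)
      next
        case False
        then have "\<alpha> (1, 0) \<noteq> t - (k + 2)"
          using d\<alpha> k by linarith
        then show ?thesis
          using False by simp
      qed
      ultimately show "coeff (monom (c \<alpha> * (real (\<alpha> (1, 0)) * (real (\<alpha> (1, 0)) - 1) * M \<alpha>)) (\<alpha> (1, 0) - 2)
          + monom (c \<alpha> * (real (d \<alpha>) * (real (d \<alpha>) + m - 2) * M \<alpha>)) (\<alpha> (1, 0))) (t - (k + 2))
        = (real t - real k) * (real t - real k - 1) * (if d \<alpha> = k then c \<alpha> * M \<alpha> else 0)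
        + (real k + 2) * (real k + m) * (if d \<alpha> = k + 2 then c \<alpha> * M \<alpha> else 0)"
        by (simp only: coeff_add)
    qed
    also have "\<dots> = (real t - real k) * (real t - real k - 1) * a k + (real k + 2) * (real k + m) * a (k + 2)"
      unfolding a_def sum.distrib sum_distrib_left ..
    finally show ?thesis
      by (simp only: mult_minus_left eq_neg_iff_add_eq_0 add.commute)
  qed
  have a_even: "a (2 * j) = a 0 * zonal_coeff m t j" for j
  proof (induction j)
    case 0
    then show ?case by simp
  next
    case (Suc j)
    show ?case
    proof (cases "2 * Suc j \<le> t")
      case True
      have j: "2 * Suc j = 2 * j + 2"
        by simp
      have "(2 * real j + 2) * (2 * real j + m) * a (2 * Suc j)
          = - ((real t - 2 * real j) * (real t - 2 * real j - 1)) * (a 0 * zonal_coeff m t j)"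
        using a_rec[of "2 * j"] True unfolding j Suc.IH of_nat_mult of_nat_numeral by blast
      also have "\<dots> = (2 * real j + 2) * (2 * real j + m) * (a 0 * zonal_coeff m t (Suc j))"
        unfolding mult.left_commute[of _ "a 0"] zonal_coeff_Suc[OF m] ..
      finally have "(2 * real j + 2) * (2 * real j + m) * a (2 * Suc j)
          = (2 * real j + 2) * (2 * real j + m) * (a 0 * zonal_coeff m t (Suc j))" .
      moreover have "(2 * real j + 2) * (2 * real j + m) > 0"
        using m by (intro mult_pos_pos add_nonneg_pos) auto
      ultimately show ?thesis
        by (metis less_irrefl mult_left_cancel)
    next
      case False
      then show ?thesis
        by (simp add: a_big zonal_coeff_eq_0)
    qed
  qed
  have "(\<Sum>\<alpha>\<in>A. c \<alpha> * (z ^ \<alpha> (1, 0) * s ^ d \<alpha> * M \<alpha>)) = a 0 * zonal m t z (s\<^sup>2)" for z s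
  proof -
    \<comment> \<open>The limit \<open>Suc (2 * t)\<close> lets the sum be grouped into pairs
      \<open>2 * j\<close>, \<open>2 * j + 1\<close> with \<open>j \<le> t\<close>, of which the odd
      members vanish.\<close>
    have "(\<Sum>\<alpha>\<in>A. c \<alpha> * (z ^ \<alpha> (1, 0) * s ^ d \<alpha> * M \<alpha>))
        = (\<Sum>\<alpha>\<in>A. \<Sum>k\<le>Suc (2 * t). (if d \<alpha> = k then c \<alpha> * M \<alpha> else 0) * (z ^ (t - k) * s ^ k))"
    proof (intro sum.cong refl)
      fix \<alpha>
      assume "\<alpha> \<in> A"
      from d[OF this] have "d \<alpha> \<in> {..Suc (2 * t)}" "\<alpha> (1, 0) = t - d \<alpha>"
        by auto
      moreover have "(\<Sum>k\<le>Suc (2 * t). (if d \<alpha> = k then c \<alpha> * M \<alpha> else 0) * (z ^ (t - k) * s ^ k))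
          = (\<Sum>k\<le>Suc (2 * t). if d \<alpha> = k then c \<alpha> * M \<alpha> * (z ^ (t - k) * s ^ k) else 0)"
        by (intro sum.cong) auto
      ultimately show "c \<alpha> * (z ^ \<alpha> (1, 0) * s ^ d \<alpha> * M \<alpha>)
          = (\<Sum>k\<le>Suc (2 * t). (if d \<alpha> = k then c \<alpha> * M \<alpha> else 0) * (z ^ (t - k) * s ^ k))"
        by (simp add: sum.delta' del: sum.atMost_Suc)
    qed
    also have "\<dots> = (\<Sum>k\<le>Suc (2 * t). a k * (z ^ (t - k) * s ^ k))"
      unfolding a_def sum_distrib_right by (rule sum.swap)
    also have "\<dots> = (\<Sum>j\<le>t. a (2 * j) * (z ^ (t - 2 * j) * s ^ (2 * j)))"
      unfolding sum.in_pairs_0 by (simp add: a_odd)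
    also have "\<dots> = a 0 * zonal m t z (s\<^sup>2)"
      unfolding zonal_def sum_distrib_left a_even power_mult by (simp only: mult.assoc)
    finally show ?thesis .
  qed
  then show ?thesis
    unfolding d_def M_def m_def by blast
qed

section \<open>Lifting a design to the larger sphere\<close>

lemma spherical_design_sum_monomial:
  fixes X :: "'a::euclidean_space set"
  assumes "spherical_design t X" "(\<Sum>b\<in>Basis. \<alpha> b) \<le> t"
  shows "(\<Sum>x\<in>X. monomial \<alpha> x)
    = real (card X) / measure (sphere_measure :: 'a measure) (sphere 0 1) * sphere_moment \<alpha>"
proof -
  have "polynomial_of_degree_le t (monomial \<alpha>)"
    unfolding polynomial_of_degree_le_def using assms(2)
    by (intro exI[of _ "{\<alpha>}"] exI[of _ "\<lambda>_. 1"]) auto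
  with assms(1) have "sphere_moment \<alpha> / measure (sphere_measure :: 'a measure) (sphere 0 1)
      = (\<Sum>x\<in>X. monomial \<alpha> x) / real (card X)"
    by (simp add: spherical_design_def sphere_moment_def)
  moreover have "real (card X) \<noteq> 0"
    using assms(1) by (simp add: spherical_design_def)
  ultimately show ?thesis
    by (simp add: field_simps)
qed

lemma monomial_scaleR: "monomial \<alpha> (s *\<^sub>R x) = s ^ (\<Sum>b\<in>Basis. \<alpha> b) * monomial \<alpha> x"
  by (simp add: monomial_def power_mult_distrib prod.distrib power_sum)

text \<open>The design turns each sum of a monomial over \<open>X\<close> into its moment times the
  common factor \<open>\<kappa>\<close>, so the sum of \<open>f\<close> is a multiple of the zonal
  value at \<open>r\<close>.\<close>

lemma lifted_design:
  fixes X :: "'a::euclidean_space set"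
  assumes X: "spherical_design t X" and r: "zonal (real DIM('a)) t r (1 - r\<^sup>2) = 0"
  shows "harmonic_index_design t {(r, sqrt (1 - r\<^sup>2) *\<^sub>R x) | x. x \<in> X}"
proof -
  define s where "s = sqrt (1 - r\<^sup>2)"
  \<comment> \<open>Hence \<open>s > 0\<close> and \<open>\<phi>\<close> is injective, so that sums
    over the image are sums over \<open>X\<close>.\<close>
  have "\<bar>r\<bar> < 1"
    using zonal_nonzero[of "real DIM('a)" r t] r by (cases "\<bar>r\<bar> < 1") auto
  then have "1 - r\<^sup>2 > 0"
    by (simp add: abs_square_less_1)
  then have s: "s > 0" "s\<^sup>2 = 1 - r\<^sup>2"
    by (simp_all add: s_def)
  define \<phi> where "\<phi> x = (r, s *\<^sub>R x)" for x :: 'a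
  have X': "{(r, sqrt (1 - r\<^sup>2) *\<^sub>R x) | x. x \<in> X} = \<phi> ` X"
    by (auto simp: \<phi>_def s_def)
  have inj: "inj_on \<phi> X"
    using s by (auto simp: inj_on_def \<phi>_def)
  have "\<phi> x \<in> sphere 0 1" if "x \<in> X" for x
  proof -
    have "norm x = 1"
      using X that by (auto simp: spherical_design_def)
    then show ?thesis
      using s by (simp add: \<phi>_def norm_Pair power_mult_distrib)
  qed
  moreover have "(\<Sum>y\<in>\<phi> ` X. f y) = 0" if f: "f \<in> Harm t" for f
  proof -
    obtain A c where A: "finite A" "\<forall>\<alpha>\<in>A. (\<Sum>b\<in>Basis. \<alpha> b) = t"
      and f_eq: "f = (\<lambda>x. \<Sum>\<alpha>\<in>A. c \<alpha> * monomial \<alpha> x)"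
      using f by (auto simp: Harm_def homogeneous_polynomial_def)
    define \<kappa> where "\<kappa> = real (card X) / measure (sphere_measure :: 'a measure) (sphere 0 1)"
    obtain C where C: "\<And>z s. (\<Sum>\<alpha>\<in>A. c \<alpha> * (z ^ \<alpha> (1, 0) * s ^ (\<Sum>b\<in>Basis. \<alpha> (0, b)) * sphere_moment (\<lambda>b. \<alpha> (0, b))))
        = C * zonal (real DIM('a)) t z (s\<^sup>2)"
      using harmonic_sphere_integral[of A t c] A f f_eq by (auto simp: Harm_def)
    have "(\<Sum>y\<in>\<phi> ` X. f y) = (\<Sum>x\<in>X. f (\<phi> x))"
      using inj by (simp add: sum.reindex)
    also have "\<dots> = (\<Sum>\<alpha>\<in>A. \<Sum>x\<in>X. c \<alpha> * monomial \<alpha> (\<phi> x))"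
      unfolding f_eq by (rule sum.swap)
    also have "\<dots> = (\<Sum>\<alpha>\<in>A. \<kappa> * (c \<alpha> * (r ^ \<alpha> (1, 0) * s ^ (\<Sum>b\<in>Basis. \<alpha> (0, b)) * sphere_moment (\<lambda>b. \<alpha> (0, b)))))"
    proof (intro sum.cong refl)
      fix \<alpha>
      assume "\<alpha> \<in> A"
      then have "(\<Sum>b\<in>Basis. \<alpha> (0, b)) \<le> t"
        using A(2) by (auto simp: sum_Basis_real_prod)
      from spherical_design_sum_monomial[OF X this]
      show "(\<Sum>x\<in>X. c \<alpha> * monomial \<alpha> (\<phi> x))
          = \<kappa> * (c \<alpha> * (r ^ \<alpha> (1, 0) * s ^ (\<Sum>b\<in>Basis. \<alpha> (0, b)) * sphere_moment (\<lambda>b. \<alpha> (0, b))))"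
        by (simp add: \<phi>_def monomial_real_prod monomial_scaleR \<kappa>_def flip: sum_distrib_left)
    qed
    also have "\<dots> = \<kappa> * (C * zonal (real DIM('a)) t r (s\<^sup>2))"
      unfolding sum_distrib_left[symmetric] C ..
    also have "\<dots> = 0"
      using r s by simp
    finally show ?thesis .
  qed
  ultimately show ?thesis
    using X unfolding X' harmonic_index_design_def by (auto simp: spherical_design_def)
qed

theorem theorem1:
  fixes n t :: nat and r :: real and X :: "(real ^ 'm) set"
  assumes "n \<ge> 2" and "t \<ge> 1" and "CARD('m) = n - 1"
    and "spherical_design t X"
    and "poly (Q_poly n t) r = 0"
  shows "harmonic_index_design t {(r, sqrt (1 - r\<^sup>2) *\<^sub>R x) | x. x \<in> X}"
proof (rule lifted_design)
  have "real DIM(real ^ 'm) = real n - 1"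
    using assms(1,3) by simp
  then show "zonal (real DIM(real ^ 'm)) t r (1 - r\<^sup>2) = 0"
    using assms(1,5) Q_poly_root_iff[of n t r] Q_at_one_pos[of n t] by simp
qed (rule assms(4))

end
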